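(* Let $\mathcal{C}$ be a bicomplete closed symmetric monoidal category. A Smith ideal $j\colon I\to R$ in $\mathcal{C}$ is equivalent to the following data: a monoid $R$ in $\mathcal{C}$, an $R$-bimodule $I$ in $\mathcal{C}$, and a morphism $j\colon I\to R$ of $R$-bimodules such that the two composites $$I\otimes_R I\xrightarrow{\,j\otimes 1\,} R\otimes_R I\xrightarrow{\ \cong\ } I\qquad\text{and}\qquad I\otimes_R I\xrightarrow{\,1\otimes j\,} I\otimes_R R\xrightarrow{\ \cong\ } I$$ are equal.
   Context: $\mathrm{Arr}\,\mathcal{C}$ is the category whose objects are morphisms of $\mathcal{C}$ and whose morphisms are commutative squares. The pushout product monoidal structure on $\mathrm{Arr}\,\mathcal{C}$ has, for $f\colon X_0\to X_1$ and $g\colon Y_0\to Y_1$, the product $f\mathbin{\square} g\colon (X_0\otimes Y_1)\amalg_{X_0\otimes Y_0}(X_1\otimes Y_0)\to X_1\otimes Y_1$ and unit $0\to S$, where $0$ is the initial object and $S$ the unit of $\mathcal{C}$. A Smith ideal in $\mathcal{C}$ is a monoid (associative and unital) $j\colon I\to R$ in the pushout product monoidal structure on $\mathrm{Arr}\,\mathcal{C}$. The tensor products $\otimes_R$ are tensor products of $R$-bimodules, and the isomorphisms are given by the left and right actions of $R$ on $I$. *)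

theory Defs
  imports Main
begin

section \<open>Categories, limits and colimits\<close>

record ('o, 'm) cat =
  Ob :: "'o set"
  Ar :: "'m set"
  Dom :: "'m \<Rightarrow> 'o"
  Cod :: "'m \<Rightarrow> 'o"
  Idt :: "'o \<Rightarrow> 'm"
  Cmp :: "'m \<Rightarrow> 'm \<Rightarrow> 'm"  (infixr "\<cdot>\<index>" 60)

definition hom :: "('o, 'm, 'x) cat_scheme \<Rightarrow> 'o \<Rightarrow> 'o \<Rightarrow> 'm set" where
  "hom C X Y = {f \<in> Ar C. Dom C f = X \<and> Cod C f = Y}"

locale category =
  fixes C :: "('o, 'm, 'x) cat_scheme" (structure)
  assumes Dom_closed: "f \<in> Ar C \<Longrightarrow> Dom C f \<in> Ob C"
    and Cod_closed: "f \<in> Ar C \<Longrightarrow> Cod C f \<in> Ob C"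
    and Idt_hom: "X \<in> Ob C \<Longrightarrow> Idt C X \<in> hom C X X"
    and Cmp_hom: "f \<in> hom C X Y \<Longrightarrow> g \<in> hom C Y Z \<Longrightarrow> g \<cdot> f \<in> hom C X Z"
    and Cmp_Idt: "f \<in> hom C X Y \<Longrightarrow> f \<cdot> Idt C X = f"
    and Idt_Cmp: "f \<in> hom C X Y \<Longrightarrow> Idt C Y \<cdot> f = f"
    and Cmp_assoc: "f \<in> hom C W X \<Longrightarrow> g \<in> hom C X Y \<Longrightarrow> h \<in> hom C Y Z \<Longrightarrow>
      (h \<cdot> g) \<cdot> f = h \<cdot> (g \<cdot> f)"

definition iso :: "('o, 'm, 'x) cat_scheme \<Rightarrow> 'm \<Rightarrow> bool" where
  "iso C f \<longleftrightarrow> f \<in> Ar C \<and>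
    (\<exists>g \<in> hom C (Cod C f) (Dom C f).
      g \<cdot>\<^bsub>C\<^esub> f = Idt C (Dom C f) \<and> f \<cdot>\<^bsub>C\<^esub> g = Idt C (Cod C f))"

definition is_functor :: "('p, 'n, 'y) cat_scheme \<Rightarrow> ('o, 'm, 'x) cat_scheme \<Rightarrow>
    ('p \<Rightarrow> 'o) \<Rightarrow> ('n \<Rightarrow> 'm) \<Rightarrow> bool" where
  "is_functor J C F\<^sub>0 F\<^sub>1 \<longleftrightarrow>
    (\<forall>a \<in> Ob J. F\<^sub>0 a \<in> Ob C) \<and>
    (\<forall>u \<in> Ar J. F\<^sub>1 u \<in> hom C (F\<^sub>0 (Dom J u)) (F\<^sub>0 (Cod J u))) \<and>
    (\<forall>a \<in> Ob J. F\<^sub>1 (Idt J a) = Idt C (F\<^sub>0 a)) \<and>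
    (\<forall>u \<in> Ar J. \<forall>v \<in> Ar J. Cod J u = Dom J v \<longrightarrow> F\<^sub>1 (v \<cdot>\<^bsub>J\<^esub> u) = F\<^sub>1 v \<cdot>\<^bsub>C\<^esub> F\<^sub>1 u)"

definition is_cone :: "('p, 'n, 'y) cat_scheme \<Rightarrow> ('o, 'm, 'x) cat_scheme \<Rightarrow>
    ('p \<Rightarrow> 'o) \<Rightarrow> ('n \<Rightarrow> 'm) \<Rightarrow> 'o \<Rightarrow> ('p \<Rightarrow> 'm) \<Rightarrow> bool" where
  "is_cone J C F\<^sub>0 F\<^sub>1 L p \<longleftrightarrow> L \<in> Ob C \<and>
    (\<forall>a \<in> Ob J. p a \<in> hom C L (F\<^sub>0 a)) \<and>
    (\<forall>u \<in> Ar J. F\<^sub>1 u \<cdot>\<^bsub>C\<^esub> p (Dom J u) = p (Cod J u))"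

definition is_limit :: "('p, 'n, 'y) cat_scheme \<Rightarrow> ('o, 'm, 'x) cat_scheme \<Rightarrow>
    ('p \<Rightarrow> 'o) \<Rightarrow> ('n \<Rightarrow> 'm) \<Rightarrow> 'o \<Rightarrow> ('p \<Rightarrow> 'm) \<Rightarrow> bool" where
  "is_limit J C F\<^sub>0 F\<^sub>1 L p \<longleftrightarrow> is_cone J C F\<^sub>0 F\<^sub>1 L p \<and>
    (\<forall>X q. is_cone J C F\<^sub>0 F\<^sub>1 X q \<longrightarrow>
      (\<exists>!h. h \<in> hom C X L \<and> (\<forall>a \<in> Ob J. p a \<cdot>\<^bsub>C\<^esub> h = q a)))"

definition is_cocone :: "('p, 'n, 'y) cat_scheme \<Rightarrow> ('o, 'm, 'x) cat_scheme \<Rightarrow>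
    ('p \<Rightarrow> 'o) \<Rightarrow> ('n \<Rightarrow> 'm) \<Rightarrow> 'o \<Rightarrow> ('p \<Rightarrow> 'm) \<Rightarrow> bool" where
  "is_cocone J C F\<^sub>0 F\<^sub>1 L i \<longleftrightarrow> L \<in> Ob C \<and>
    (\<forall>a \<in> Ob J. i a \<in> hom C (F\<^sub>0 a) L) \<and>
    (\<forall>u \<in> Ar J. i (Cod J u) \<cdot>\<^bsub>C\<^esub> F\<^sub>1 u = i (Dom J u))"

definition is_colimit :: "('p, 'n, 'y) cat_scheme \<Rightarrow> ('o, 'm, 'x) cat_scheme \<Rightarrow>
    ('p \<Rightarrow> 'o) \<Rightarrow> ('n \<Rightarrow> 'm) \<Rightarrow> 'o \<Rightarrow> ('p \<Rightarrow> 'm) \<Rightarrow> bool" where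
  "is_colimit J C F\<^sub>0 F\<^sub>1 L i \<longleftrightarrow> is_cocone J C F\<^sub>0 F\<^sub>1 L i \<and>
    (\<forall>X q. is_cocone J C F\<^sub>0 F\<^sub>1 X q \<longrightarrow>
      (\<exists>!h. h \<in> hom C L X \<and> (\<forall>a \<in> Ob J. h \<cdot>\<^bsub>C\<^esub> i a = q a)))"

text \<open>The type \<open>'u\<close> bounds the size of diagrams: a small category is one whose objects and
  arrows are elements of \<open>'u\<close>. A category with all limits and colimits in the usual sense is
  bicomplete for every \<open>'u\<close> that is itself small; finite diagrams are covered as soon as \<open>'u\<close> is infinite.\<close>

definition bicomplete :: "'u itself \<Rightarrow> ('o, 'm, 'x) cat_scheme \<Rightarrow> bool" where
  "bicomplete U C \<longleftrightarrow>
    (\<forall>(J :: ('u, 'u) cat) F\<^sub>0 F\<^sub>1. category J \<and> is_functor J C F\<^sub>0 F\<^sub>1 \<longrightarrow>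
      (\<exists>L p. is_limit J C F\<^sub>0 F\<^sub>1 L p) \<and> (\<exists>L i. is_colimit J C F\<^sub>0 F\<^sub>1 L i))"

text \<open>Particular colimits. The operations with \<open>SOME\<close> pick one colimit, without any further
  requirement on the choice.\<close>

definition is_initial :: "('o, 'm, 'x) cat_scheme \<Rightarrow> 'o \<Rightarrow> bool" where
  "is_initial C Z \<longleftrightarrow> Z \<in> Ob C \<and> (\<forall>X \<in> Ob C. \<exists>!h. h \<in> hom C Z X)"

definition initial :: "('o, 'm, 'x) cat_scheme \<Rightarrow> 'o" where
  "initial C = (SOME Z. is_initial C Z)"

definition from_initial :: "('o, 'm, 'x) cat_scheme \<Rightarrow> 'o \<Rightarrow> 'm" where
  "from_initial C X = (THE h. h \<in> hom C (initial C) X)"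

definition is_pushout :: "('o, 'm, 'x) cat_scheme \<Rightarrow> 'm \<Rightarrow> 'm \<Rightarrow> 'm \<Rightarrow> 'm \<Rightarrow> bool" where
  "is_pushout C f g i j \<longleftrightarrow>
    f \<in> Ar C \<and> g \<in> Ar C \<and> Dom C f = Dom C g \<and>
    i \<in> Ar C \<and> j \<in> Ar C \<and> Dom C i = Cod C f \<and> Dom C j = Cod C g \<and> Cod C i = Cod C j \<and>
    i \<cdot>\<^bsub>C\<^esub> f = j \<cdot>\<^bsub>C\<^esub> g \<and>
    (\<forall>X u v. u \<in> hom C (Cod C f) X \<and> v \<in> hom C (Cod C g) X \<and> u \<cdot>\<^bsub>C\<^esub> f = v \<cdot>\<^bsub>C\<^esub> g \<longrightarrow>
      (\<exists>!h. h \<in> hom C (Cod C i) X \<and> h \<cdot>\<^bsub>C\<^esub> i = u \<and> h \<cdot>\<^bsub>C\<^esub> j = v))"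

definition pushout :: "('o, 'm, 'x) cat_scheme \<Rightarrow> 'm \<Rightarrow> 'm \<Rightarrow> 'm \<times> 'm" where
  "pushout C f g = (SOME p. is_pushout C f g (fst p) (snd p))"

definition copair :: "('o, 'm, 'x) cat_scheme \<Rightarrow> 'm \<times> 'm \<Rightarrow> 'm \<Rightarrow> 'm \<Rightarrow> 'm" where
  "copair C p u v = (THE h. h \<in> hom C (Cod C (fst p)) (Cod C u) \<and>
    h \<cdot>\<^bsub>C\<^esub> fst p = u \<and> h \<cdot>\<^bsub>C\<^esub> snd p = v)"

definition is_coequalizer :: "('o, 'm, 'x) cat_scheme \<Rightarrow> 'm \<Rightarrow> 'm \<Rightarrow> 'm \<Rightarrow> bool" where
  "is_coequalizer C f g q \<longleftrightarrow>
    f \<in> Ar C \<and> g \<in> Ar C \<and> Dom C f = Dom C g \<and> Cod C f = Cod C g \<and>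
    q \<in> Ar C \<and> Dom C q = Cod C f \<and> q \<cdot>\<^bsub>C\<^esub> f = q \<cdot>\<^bsub>C\<^esub> g \<and>
    (\<forall>X u. u \<in> hom C (Cod C f) X \<and> u \<cdot>\<^bsub>C\<^esub> f = u \<cdot>\<^bsub>C\<^esub> g \<longrightarrow>
      (\<exists>!h. h \<in> hom C (Cod C q) X \<and> h \<cdot>\<^bsub>C\<^esub> q = u))"

definition coequalizer :: "('o, 'm, 'x) cat_scheme \<Rightarrow> 'm \<Rightarrow> 'm \<Rightarrow> 'm" where
  "coequalizer C f g = (SOME q. is_coequalizer C f g q)"


section \<open>Closed symmetric monoidal categories\<close>

record ('o, 'm) moncat = "('o, 'm) cat" +
  Tens_ob :: "'o \<Rightarrow> 'o \<Rightarrow> 'o"  (infixr "\<otimes>\<^sub>o\<index>" 70)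
  Tens :: "'m \<Rightarrow> 'm \<Rightarrow> 'm"  (infixr "\<otimes>\<index>" 70)
  Unt :: "'o"
  Assoc :: "'o \<Rightarrow> 'o \<Rightarrow> 'o \<Rightarrow> 'm"
  Lunit :: "'o \<Rightarrow> 'm"
  Runit :: "'o \<Rightarrow> 'm"

locale monoidal_category = category C
  for C :: "('o, 'm, 'x) moncat_scheme" (structure) +
  assumes Tens_ob_closed: "X \<in> Ob C \<Longrightarrow> Y \<in> Ob C \<Longrightarrow> X \<otimes>\<^sub>o Y \<in> Ob C"
    and Tens_hom: "f \<in> hom C X X' \<Longrightarrow> g \<in> hom C Y Y' \<Longrightarrow> f \<otimes> g \<in> hom C (X \<otimes>\<^sub>o Y) (X' \<otimes>\<^sub>o Y')"
    and Tens_Idt: "X \<in> Ob C \<Longrightarrow> Y \<in> Ob C \<Longrightarrow> Idt C X \<otimes> Idt C Y = Idt C (X \<otimes>\<^sub>o Y)"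
    and Tens_Cmp: "f \<in> hom C X X' \<Longrightarrow> f' \<in> hom C X' X'' \<Longrightarrow>
      g \<in> hom C Y Y' \<Longrightarrow> g' \<in> hom C Y' Y'' \<Longrightarrow>
      (f' \<cdot> f) \<otimes> (g' \<cdot> g) = (f' \<otimes> g') \<cdot> (f \<otimes> g)"
    and Unt_closed: "Unt C \<in> Ob C"
    and Assoc_hom: "X \<in> Ob C \<Longrightarrow> Y \<in> Ob C \<Longrightarrow> Z \<in> Ob C \<Longrightarrow>
      Assoc C X Y Z \<in> hom C ((X \<otimes>\<^sub>o Y) \<otimes>\<^sub>o Z) (X \<otimes>\<^sub>o (Y \<otimes>\<^sub>o Z))"
    and Assoc_iso: "X \<in> Ob C \<Longrightarrow> Y \<in> Ob C \<Longrightarrow> Z \<in> Ob C \<Longrightarrow> iso C (Assoc C X Y Z)"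
    and Assoc_natural: "f \<in> hom C X X' \<Longrightarrow> g \<in> hom C Y Y' \<Longrightarrow> h \<in> hom C Z Z' \<Longrightarrow>
      Assoc C X' Y' Z' \<cdot> ((f \<otimes> g) \<otimes> h) = (f \<otimes> (g \<otimes> h)) \<cdot> Assoc C X Y Z"
    and Lunit_hom: "X \<in> Ob C \<Longrightarrow> Lunit C X \<in> hom C (Unt C \<otimes>\<^sub>o X) X"
    and Lunit_iso: "X \<in> Ob C \<Longrightarrow> iso C (Lunit C X)"
    and Lunit_natural: "f \<in> hom C X X' \<Longrightarrow> Lunit C X' \<cdot> (Idt C (Unt C) \<otimes> f) = f \<cdot> Lunit C X"
    and Runit_hom: "X \<in> Ob C \<Longrightarrow> Runit C X \<in> hom C (X \<otimes>\<^sub>o Unt C) X"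
    and Runit_iso: "X \<in> Ob C \<Longrightarrow> iso C (Runit C X)"
    and Runit_natural: "f \<in> hom C X X' \<Longrightarrow> Runit C X' \<cdot> (f \<otimes> Idt C (Unt C)) = f \<cdot> Runit C X"
    and pentagon: "W \<in> Ob C \<Longrightarrow> X \<in> Ob C \<Longrightarrow> Y \<in> Ob C \<Longrightarrow> Z \<in> Ob C \<Longrightarrow>
      Assoc C W X (Y \<otimes>\<^sub>o Z) \<cdot> Assoc C (W \<otimes>\<^sub>o X) Y Z =
      (Idt C W \<otimes> Assoc C X Y Z) \<cdot> Assoc C W (X \<otimes>\<^sub>o Y) Z \<cdot> (Assoc C W X Y \<otimes> Idt C Z)"
    and triangle: "X \<in> Ob C \<Longrightarrow> Y \<in> Ob C \<Longrightarrow>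
      (Idt C X \<otimes> Lunit C Y) \<cdot> Assoc C X (Unt C) Y = Runit C X \<otimes> Idt C Y"

record ('o, 'm) symmoncat = "('o, 'm) moncat" +
  Braid :: "'o \<Rightarrow> 'o \<Rightarrow> 'm"

locale symmetric_monoidal_category = monoidal_category C
  for C :: "('o, 'm, 'x) symmoncat_scheme" (structure) +
  assumes Braid_hom: "X \<in> Ob C \<Longrightarrow> Y \<in> Ob C \<Longrightarrow> Braid C X Y \<in> hom C (X \<otimes>\<^sub>o Y) (Y \<otimes>\<^sub>o X)"
    and Braid_natural: "f \<in> hom C X X' \<Longrightarrow> g \<in> hom C Y Y' \<Longrightarrow>
      Braid C X' Y' \<cdot> (f \<otimes> g) = (g \<otimes> f) \<cdot> Braid C X Y"
    and Braid_Braid: "X \<in> Ob C \<Longrightarrow> Y \<in> Ob C \<Longrightarrow> Braid C Y X \<cdot> Braid C X Y = Idt C (X \<otimes>\<^sub>o Y)"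
    and hexagon: "X \<in> Ob C \<Longrightarrow> Y \<in> Ob C \<Longrightarrow> Z \<in> Ob C \<Longrightarrow>
      Assoc C Y Z X \<cdot> Braid C X (Y \<otimes>\<^sub>o Z) \<cdot> Assoc C X Y Z =
      (Idt C Y \<otimes> Braid C X Z) \<cdot> Assoc C Y X Z \<cdot> (Braid C X Y \<otimes> Idt C Z)"

text \<open>Each functor \<open>- \<otimes> Y\<close> has a right adjoint, given by universal arrows; by symmetry the same
  then holds for \<open>Y \<otimes> -\<close>.\<close>

locale closed_symmetric_monoidal_category = symmetric_monoidal_category C
  for C :: "('o, 'm, 'x) symmoncat_scheme" (structure) +
  assumes internal_hom: "Y \<in> Ob C \<Longrightarrow> Z \<in> Ob C \<Longrightarrow>
    \<exists>H \<in> Ob C. \<exists>ev \<in> hom C (H \<otimes>\<^sub>o Y) Z. \<forall>X \<in> Ob C. \<forall>f \<in> hom C (X \<otimes>\<^sub>o Y) Z.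
      \<exists>!g. g \<in> hom C X H \<and> ev \<cdot> (g \<otimes> Idt C Y) = f"


section \<open>Monoids and bimodules\<close>

record ('o, 'm) mon =
  mon_ob :: "'o"
  mon_mult :: "'m"
  mon_unit :: "'m"

definition is_monoid :: "('o, 'm, 'x) moncat_scheme \<Rightarrow> ('o, 'm) mon \<Rightarrow> bool" where
  "is_monoid C A \<longleftrightarrow>
    (let a = mon_ob A; m = mon_mult A; e = mon_unit A in
      a \<in> Ob C \<and> m \<in> hom C (a \<otimes>\<^sub>o\<^bsub>C\<^esub> a) a \<and> e \<in> hom C (Unt C) a \<and>
      m \<cdot>\<^bsub>C\<^esub> (m \<otimes>\<^bsub>C\<^esub> Idt C a) = m \<cdot>\<^bsub>C\<^esub> (Idt C a \<otimes>\<^bsub>C\<^esub> m) \<cdot>\<^bsub>C\<^esub> Assoc C a a a \<and>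
      m \<cdot>\<^bsub>C\<^esub> (e \<otimes>\<^bsub>C\<^esub> Idt C a) = Lunit C a \<and>
      m \<cdot>\<^bsub>C\<^esub> (Idt C a \<otimes>\<^bsub>C\<^esub> e) = Runit C a)"

record ('o, 'm) bimod =
  bm_ob :: "'o"
  bm_lact :: "'m"
  bm_ract :: "'m"

definition is_bimodule :: "('o, 'm, 'x) moncat_scheme \<Rightarrow> ('o, 'm) mon \<Rightarrow> ('o, 'm) bimod \<Rightarrow> bool" where
  "is_bimodule C R M \<longleftrightarrow>
    (let r = mon_ob R; m = mon_mult R; e = mon_unit R;
         x = bm_ob M; l = bm_lact M; k = bm_ract M in
      x \<in> Ob C \<and> l \<in> hom C (r \<otimes>\<^sub>o\<^bsub>C\<^esub> x) x \<and> k \<in> hom C (x \<otimes>\<^sub>o\<^bsub>C\<^esub> r) x \<and>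
      l \<cdot>\<^bsub>C\<^esub> (m \<otimes>\<^bsub>C\<^esub> Idt C x) = l \<cdot>\<^bsub>C\<^esub> (Idt C r \<otimes>\<^bsub>C\<^esub> l) \<cdot>\<^bsub>C\<^esub> Assoc C r r x \<and>
      l \<cdot>\<^bsub>C\<^esub> (e \<otimes>\<^bsub>C\<^esub> Idt C x) = Lunit C x \<and>
      k \<cdot>\<^bsub>C\<^esub> (k \<otimes>\<^bsub>C\<^esub> Idt C r) = k \<cdot>\<^bsub>C\<^esub> (Idt C x \<otimes>\<^bsub>C\<^esub> m) \<cdot>\<^bsub>C\<^esub> Assoc C x r r \<and>
      k \<cdot>\<^bsub>C\<^esub> (Idt C x \<otimes>\<^bsub>C\<^esub> e) = Runit C x \<and>
      k \<cdot>\<^bsub>C\<^esub> (l \<otimes>\<^bsub>C\<^esub> Idt C r) = l \<cdot>\<^bsub>C\<^esub> (Idt C r \<otimes>\<^bsub>C\<^esub> k) \<cdot>\<^bsub>C\<^esub> Assoc C r x r)"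

definition regular_bimodule :: "('o, 'm) mon \<Rightarrow> ('o, 'm) bimod" where
  "regular_bimodule R = \<lparr>bm_ob = mon_ob R, bm_lact = mon_mult R, bm_ract = mon_mult R\<rparr>"

definition is_bimodule_map :: "('o, 'm, 'x) moncat_scheme \<Rightarrow> ('o, 'm) mon \<Rightarrow>
    ('o, 'm) bimod \<Rightarrow> ('o, 'm) bimod \<Rightarrow> 'm \<Rightarrow> bool" where
  "is_bimodule_map C R M N f \<longleftrightarrow>
    f \<in> hom C (bm_ob M) (bm_ob N) \<and>
    f \<cdot>\<^bsub>C\<^esub> bm_lact M = bm_lact N \<cdot>\<^bsub>C\<^esub> (Idt C (mon_ob R) \<otimes>\<^bsub>C\<^esub> f) \<and>
    f \<cdot>\<^bsub>C\<^esub> bm_ract M = bm_ract N \<cdot>\<^bsub>C\<^esub> (f \<otimes>\<^bsub>C\<^esub> Idt C (mon_ob R))"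

text \<open>The quotient map \<open>M \<otimes> N \<rightarrow> M \<otimes>\<^sub>R N\<close>, that is, the coequalizer of
  \<open>(M \<otimes> R) \<otimes> N \<rightrightarrows> M \<otimes> N\<close>. The object \<open>M \<otimes>\<^sub>R N\<close> is its codomain; its
  bimodule structure is not recorded, since maps out of it are compared as arrows of \<open>C\<close>.\<close>

definition tensor_over_proj :: "('o, 'm, 'x) moncat_scheme \<Rightarrow> ('o, 'm) mon \<Rightarrow>
    ('o, 'm) bimod \<Rightarrow> ('o, 'm) bimod \<Rightarrow> 'm" where
  "tensor_over_proj C R M N = coequalizer C
    (bm_ract M \<otimes>\<^bsub>C\<^esub> Idt C (bm_ob N))
    ((Idt C (bm_ob M) \<otimes>\<^bsub>C\<^esub> bm_lact N) \<cdot>\<^bsub>C\<^esub> Assoc C (bm_ob M) (mon_ob R) (bm_ob N))"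

definition tensor_over_ob :: "('o, 'm, 'x) moncat_scheme \<Rightarrow> ('o, 'm) mon \<Rightarrow>
    ('o, 'm) bimod \<Rightarrow> ('o, 'm) bimod \<Rightarrow> 'o" where
  "tensor_over_ob C R M N = Cod C (tensor_over_proj C R M N)"

text \<open>The map \<open>f \<otimes>\<^sub>R g : M \<otimes>\<^sub>R N \<rightarrow> M' \<otimes>\<^sub>R N'\<close> induced by bimodule maps \<open>f : M \<rightarrow> M'\<close>, \<open>g : N \<rightarrow> N'\<close>.\<close>

definition tensor_over_map :: "('o, 'm, 'x) moncat_scheme \<Rightarrow> ('o, 'm) mon \<Rightarrow>
    ('o, 'm) bimod \<Rightarrow> ('o, 'm) bimod \<Rightarrow> ('o, 'm) bimod \<Rightarrow> ('o, 'm) bimod \<Rightarrow> 'm \<Rightarrow> 'm \<Rightarrow> 'm" where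
  "tensor_over_map C R M N M' N' f g =
    (THE h. h \<in> hom C (tensor_over_ob C R M N) (tensor_over_ob C R M' N') \<and>
      h \<cdot>\<^bsub>C\<^esub> tensor_over_proj C R M N = tensor_over_proj C R M' N' \<cdot>\<^bsub>C\<^esub> (f \<otimes>\<^bsub>C\<^esub> g))"

text \<open>The isomorphisms \<open>R \<otimes>\<^sub>R M \<cong> M\<close> and \<open>M \<otimes>\<^sub>R R \<cong> M\<close> induced by the two actions.\<close>

definition lact_iso :: "('o, 'm, 'x) moncat_scheme \<Rightarrow> ('o, 'm) mon \<Rightarrow> ('o, 'm) bimod \<Rightarrow> 'm" where
  "lact_iso C R M =
    (THE h. h \<in> hom C (tensor_over_ob C R (regular_bimodule R) M) (bm_ob M) \<and>
      h \<cdot>\<^bsub>C\<^esub> tensor_over_proj C R (regular_bimodule R) M = bm_lact M)"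

definition ract_iso :: "('o, 'm, 'x) moncat_scheme \<Rightarrow> ('o, 'm) mon \<Rightarrow> ('o, 'm) bimod \<Rightarrow> 'm" where
  "ract_iso C R M =
    (THE h. h \<in> hom C (tensor_over_ob C R M (regular_bimodule R)) (bm_ob M) \<and>
      h \<cdot>\<^bsub>C\<^esub> tensor_over_proj C R M (regular_bimodule R) = bm_ract M)"


section \<open>The arrow category and the pushout product\<close>

text \<open>A square from \<open>f : X\<^sub>0 \<rightarrow> X\<^sub>1\<close> to \<open>g : Y\<^sub>0 \<rightarrow> Y\<^sub>1\<close>: the component \<open>X\<^sub>0 \<rightarrow> Y\<^sub>0\<close> is \<open>sq_top\<close>,
  the component \<open>X\<^sub>1 \<rightarrow> Y\<^sub>1\<close> is \<open>sq_bot\<close>.\<close>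

datatype 'm square = Square (sq_src: 'm) (sq_tgt: 'm) (sq_top: 'm) (sq_bot: 'm)

definition Arr :: "('o, 'm, 'x) cat_scheme \<Rightarrow> ('m, 'm square) cat" where
  "Arr C = \<lparr>
    Ob = Ar C,
    Ar = {s. sq_src s \<in> Ar C \<and> sq_tgt s \<in> Ar C \<and>
      sq_top s \<in> hom C (Dom C (sq_src s)) (Dom C (sq_tgt s)) \<and>
      sq_bot s \<in> hom C (Cod C (sq_src s)) (Cod C (sq_tgt s)) \<and>
      sq_tgt s \<cdot>\<^bsub>C\<^esub> sq_top s = sq_bot s \<cdot>\<^bsub>C\<^esub> sq_src s},
    Dom = sq_src,
    Cod = sq_tgt,
    Idt = (\<lambda>f. Square f f (Idt C (Dom C f)) (Idt C (Cod C f))),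
    Cmp = (\<lambda>t s. Square (sq_src s) (sq_tgt t) (sq_top t \<cdot>\<^bsub>C\<^esub> sq_top s) (sq_bot t \<cdot>\<^bsub>C\<^esub> sq_bot s))\<rparr>"

lemma category_Arr:
  assumes "category C"
  shows "category (Arr C)"
proof -
  interpret category C by fact
  show ?thesis
  proof
    fix s t f g h
    assume s: "s \<in> hom (Arr C) f g" and t: "t \<in> hom (Arr C) g h"
    let ?s0 = "sq_top s" and ?s1 = "sq_bot s" and ?t0 = "sq_top t" and ?t1 = "sq_bot t"
    have ar: "f \<in> hom C (Dom C f) (Cod C f)" "g \<in> hom C (Dom C g) (Cod C g)"
      "h \<in> hom C (Dom C h) (Cod C h)"
      using s t by (auto simp: Arr_def hom_def)
    have s': "?s0 \<in> hom C (Dom C f) (Dom C g)" "?s1 \<in> hom C (Cod C f) (Cod C g)"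
      "g \<cdot>\<^bsub>C\<^esub> ?s0 = ?s1 \<cdot>\<^bsub>C\<^esub> f"
      using s by (auto simp: Arr_def hom_def)
    have t': "?t0 \<in> hom C (Dom C g) (Dom C h)" "?t1 \<in> hom C (Cod C g) (Cod C h)"
      "h \<cdot>\<^bsub>C\<^esub> ?t0 = ?t1 \<cdot>\<^bsub>C\<^esub> g"
      using t by (auto simp: Arr_def hom_def)
    have "h \<cdot>\<^bsub>C\<^esub> ?t0 \<cdot>\<^bsub>C\<^esub> ?s0 = (?t1 \<cdot>\<^bsub>C\<^esub> g) \<cdot>\<^bsub>C\<^esub> ?s0"
      using Cmp_assoc[OF s'(1) t'(1) ar(3)] t'(3) by simp
    also have "\<dots> = (?t1 \<cdot>\<^bsub>C\<^esub> ?s1) \<cdot>\<^bsub>C\<^esub> f"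
      using Cmp_assoc[OF s'(1) ar(2) t'(2)] Cmp_assoc[OF ar(1) s'(2) t'(2)] s'(3) by simp
    finally show "t \<cdot>\<^bsub>Arr C\<^esub> s \<in> hom (Arr C) f h"
      using s t Cmp_hom[OF s'(1) t'(1)] Cmp_hom[OF s'(2) t'(2)]
      by (auto simp: Arr_def hom_def)
  next
    fix f
    assume "f \<in> Ob (Arr C)"
    then have f: "f \<in> hom C (Dom C f) (Cod C f)"
      by (simp add: Arr_def hom_def)
    then have "Dom C f \<in> Ob C" "Cod C f \<in> Ob C"
      using Dom_closed Cod_closed by (auto simp: hom_def)
    then show "Idt (Arr C) f \<in> hom (Arr C) f f"
      using f Cmp_Idt[OF f] Idt_Cmp[OF f] Idt_hom by (auto simp: Arr_def hom_def)
  next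
    fix e f g h r s t
    assume "r \<in> hom (Arr C) e f" "s \<in> hom (Arr C) f g" "t \<in> hom (Arr C) g h"
    then show "(t \<cdot>\<^bsub>Arr C\<^esub> s) \<cdot>\<^bsub>Arr C\<^esub> r = t \<cdot>\<^bsub>Arr C\<^esub> (s \<cdot>\<^bsub>Arr C\<^esub> r)"
      using Cmp_assoc by (auto simp: Arr_def hom_def)
  qed (auto simp: Arr_def hom_def Cmp_Idt[unfolded hom_def, simplified]
      Idt_Cmp[unfolded hom_def, simplified] intro!: square.expand)
qed

text \<open>For \<open>f : X\<^sub>0 \<rightarrow> X\<^sub>1\<close> and \<open>g : Y\<^sub>0 \<rightarrow> Y\<^sub>1\<close>, the two coprojections
  \<open>X\<^sub>0 \<otimes> Y\<^sub>1 \<rightarrow> P \<leftarrow> X\<^sub>1 \<otimes> Y\<^sub>0\<close> of the pushout \<open>P\<close> of \<open>X\<^sub>0 \<otimes> Y\<^sub>1 \<leftarrow> X\<^sub>0 \<otimes> Y\<^sub>0 \<rightarrow> X\<^sub>1 \<otimes> Y\<^sub>0\<close>.\<close>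

definition pp_cocone :: "('o, 'm, 'x) moncat_scheme \<Rightarrow> 'm \<Rightarrow> 'm \<Rightarrow> 'm \<times> 'm" where
  "pp_cocone C f g = pushout C (Idt C (Dom C f) \<otimes>\<^bsub>C\<^esub> g) (f \<otimes>\<^bsub>C\<^esub> Idt C (Dom C g))"

abbreviation pp_in1 :: "('o, 'm, 'x) moncat_scheme \<Rightarrow> 'm \<Rightarrow> 'm \<Rightarrow> 'm" where
  "pp_in1 C f g \<equiv> fst (pp_cocone C f g)"

abbreviation pp_in2 :: "('o, 'm, 'x) moncat_scheme \<Rightarrow> 'm \<Rightarrow> 'm \<Rightarrow> 'm" where
  "pp_in2 C f g \<equiv> snd (pp_cocone C f g)"

definition pp_ob :: "('o, 'm, 'x) moncat_scheme \<Rightarrow> 'm \<Rightarrow> 'm \<Rightarrow> 'm" where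
  "pp_ob C f g = copair C (pp_cocone C f g) (f \<otimes>\<^bsub>C\<^esub> Idt C (Cod C g)) (Idt C (Cod C f) \<otimes>\<^bsub>C\<^esub> g)"

definition pp_map :: "('o, 'm, 'x) moncat_scheme \<Rightarrow> 'm square \<Rightarrow> 'm square \<Rightarrow> 'm square" where
  "pp_map C s t =
    (let f = sq_src s; g = sq_src t; f' = sq_tgt s; g' = sq_tgt t in
      Square (pp_ob C f g) (pp_ob C f' g')
        (copair C (pp_cocone C f g)
          (pp_in1 C f' g' \<cdot>\<^bsub>C\<^esub> (sq_top s \<otimes>\<^bsub>C\<^esub> sq_bot t))
          (pp_in2 C f' g' \<cdot>\<^bsub>C\<^esub> (sq_bot s \<otimes>\<^bsub>C\<^esub> sq_top t)))
        (sq_bot s \<otimes>\<^bsub>C\<^esub> sq_bot t))"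

definition pp_unit :: "('o, 'm, 'x) moncat_scheme \<Rightarrow> 'm" where
  "pp_unit C = from_initial C (Unt C)"

text \<open>Since \<open>- \<otimes> Z\<^sub>1\<close> preserves pushouts, a map out of the domain of \<open>(f \<box> g) \<box> h\<close> is determined
  by its restrictions to \<open>(X\<^sub>0 \<otimes> Y\<^sub>1) \<otimes> Z\<^sub>1\<close>, \<open>(X\<^sub>1 \<otimes> Y\<^sub>0) \<otimes> Z\<^sub>1\<close> and \<open>(X\<^sub>1 \<otimes> Y\<^sub>1) \<otimes> Z\<^sub>0\<close>. On each of these
  the associator of the arrow category is the associator of \<open>C\<close>.\<close>

definition pp_assoc :: "('o, 'm, 'x) moncat_scheme \<Rightarrow> 'm \<Rightarrow> 'm \<Rightarrow> 'm \<Rightarrow> 'm square" where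
  "pp_assoc C f g h =
    (let X\<^sub>0 = Dom C f; X\<^sub>1 = Cod C f; Y\<^sub>0 = Dom C g; Y\<^sub>1 = Cod C g; Z\<^sub>0 = Dom C h; Z\<^sub>1 = Cod C h;
         fg = pp_ob C f g; gh = pp_ob C g h in
      Square (pp_ob C fg h) (pp_ob C f gh)
        (THE t. t \<in> hom C (Dom C (pp_ob C fg h)) (Dom C (pp_ob C f gh)) \<and>
          t \<cdot>\<^bsub>C\<^esub> pp_in1 C fg h \<cdot>\<^bsub>C\<^esub> (pp_in1 C f g \<otimes>\<^bsub>C\<^esub> Idt C Z\<^sub>1) =
            pp_in1 C f gh \<cdot>\<^bsub>C\<^esub> Assoc C X\<^sub>0 Y\<^sub>1 Z\<^sub>1 \<and>
          t \<cdot>\<^bsub>C\<^esub> pp_in1 C fg h \<cdot>\<^bsub>C\<^esub> (pp_in2 C f g \<otimes>\<^bsub>C\<^esub> Idt C Z\<^sub>1) =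
            pp_in2 C f gh \<cdot>\<^bsub>C\<^esub> (Idt C X\<^sub>1 \<otimes>\<^bsub>C\<^esub> pp_in1 C g h) \<cdot>\<^bsub>C\<^esub> Assoc C X\<^sub>1 Y\<^sub>0 Z\<^sub>1 \<and>
          t \<cdot>\<^bsub>C\<^esub> pp_in2 C fg h =
            pp_in2 C f gh \<cdot>\<^bsub>C\<^esub> (Idt C X\<^sub>1 \<otimes>\<^bsub>C\<^esub> pp_in2 C g h) \<cdot>\<^bsub>C\<^esub> Assoc C X\<^sub>1 Y\<^sub>1 Z\<^sub>0)
        (Assoc C X\<^sub>1 Y\<^sub>1 Z\<^sub>1))"

text \<open>As \<open>0 \<otimes> Y\<close> and \<open>X \<otimes> 0\<close> are initial, the domain of \<open>(0 \<rightarrow> S) \<box> f\<close> is \<open>S \<otimes> X\<^sub>0\<close> and the domain of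
  \<open>f \<box> (0 \<rightarrow> S)\<close> is \<open>X\<^sub>0 \<otimes> S\<close>, via the second and the first coprojection respectively.\<close>

definition pp_lunit :: "('o, 'm, 'x) moncat_scheme \<Rightarrow> 'm \<Rightarrow> 'm square" where
  "pp_lunit C f = Square (pp_ob C (pp_unit C) f) f
    (THE t. t \<in> hom C (Dom C (pp_ob C (pp_unit C) f)) (Dom C f) \<and>
      t \<cdot>\<^bsub>C\<^esub> pp_in2 C (pp_unit C) f = Lunit C (Dom C f))
    (Lunit C (Cod C f))"

definition pp_runit :: "('o, 'm, 'x) moncat_scheme \<Rightarrow> 'm \<Rightarrow> 'm square" where
  "pp_runit C f = Square (pp_ob C f (pp_unit C)) f
    (THE t. t \<in> hom C (Dom C (pp_ob C f (pp_unit C))) (Dom C f) \<and>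
      t \<cdot>\<^bsub>C\<^esub> pp_in1 C f (pp_unit C) = Runit C (Dom C f))
    (Runit C (Cod C f))"

definition Arr_pp :: "('o, 'm, 'x) moncat_scheme \<Rightarrow> ('m, 'm square) moncat" where
  "Arr_pp C = \<lparr>
    Ob = Ob (Arr C),
    Ar = Ar (Arr C),
    Dom = Dom (Arr C),
    Cod = Cod (Arr C),
    Idt = Idt (Arr C),
    Cmp = Cmp (Arr C),
    Tens_ob = pp_ob C,
    Tens = pp_map C,
    Unt = pp_unit C,
    Assoc = pp_assoc C,
    Lunit = pp_lunit C,
    Runit = pp_runit C\<rparr>"


section \<open>Smith ideals\<close>

text \<open>The mathematical Smith ideal \<open>j : I \<rightarrow> R\<close> is \<open>mon_ob A\<close>, with its monoid structure in \<open>A\<close>.\<close>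

definition is_smith_ideal :: "('o, 'm, 'x) moncat_scheme \<Rightarrow> ('m, 'm square) mon \<Rightarrow> bool" where
  "is_smith_ideal C A \<longleftrightarrow> is_monoid (Arr_pp C) A"

text \<open>The data \<open>(R, I, j)\<close> of a Smith ideal: the lower components of multiplication and unit make
  \<open>R\<close> a monoid, and the upper component \<open>(I \<otimes> R) \<amalg> (R \<otimes> I) \<rightarrow> I\<close> of the multiplication (the pushout
  taken over \<open>I \<otimes> I\<close>) restricts to the right and left action of \<open>R\<close> on \<open>I\<close>.\<close>

definition smith_data :: "('o, 'm, 'x) moncat_scheme \<Rightarrow> ('m, 'm square) mon \<Rightarrow>
    ('o, 'm) mon \<times> ('o, 'm) bimod \<times> 'm" where
  "smith_data C A =
    (let j = mon_ob A; \<mu> = mon_mult A; \<eta> = mon_unit A in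
      (\<lparr>mon_ob = Cod C j, mon_mult = sq_bot \<mu>, mon_unit = sq_bot \<eta>\<rparr>,
       \<lparr>bm_ob = Dom C j,
        bm_lact = sq_top \<mu> \<cdot>\<^bsub>C\<^esub> pp_in2 C j j,
        bm_ract = sq_top \<mu> \<cdot>\<^bsub>C\<^esub> pp_in1 C j j\<rparr>,
       j))"

end

theory Submission
  imports Defs
begin

text \<open>
  Both sides of the correspondence say the same thing about maps out of a pushout. The lower
  components of a monoid structure on \<open>j : I \<rightarrow> R\<close> in the arrow category are a multiplication and a
  unit on \<open>R\<close>. The upper component of the unit is a map out of the initial object and carries no
  information. The upper component of the multiplication is a map from
  \<open>(I \<otimes> R) \<amalg> (R \<otimes> I)\<close>, glued along \<open>I \<otimes> I\<close>, to \<open>I\<close>: a pair of maps \<open>k : I \<otimes> R \<rightarrow> I\<close> and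
  \<open>l : R \<otimes> I \<rightarrow> I\<close> with \<open>k (1 \<otimes> j) = l (j \<otimes> 1)\<close>. This gluing condition is the equality of the two
  composites \<open>I \<otimes>\<^sub>R I \<rightarrow> I\<close>, since the quotient map \<open>I \<otimes> I \<rightarrow> I \<otimes>\<^sub>R I\<close> is an epimorphism
  along which the composites restrict to \<open>l (j \<otimes> 1)\<close> and \<open>k (1 \<otimes> j)\<close> (\<open>tensor_condition_iff\<close>).

  The remaining conditions correspond one by one (\<open>is_smith_ideal_iff\<close>). The multiplication square
  commutes iff \<open>j\<close> is compatible with \<open>k\<close> and with \<open>l\<close> (\<open>mult_square_iff\<close>). Its associativity,
  restricted to the three summands \<open>(I \<otimes> R) \<otimes> R\<close>, \<open>(R \<otimes> I) \<otimes> R\<close> and \<open>(R \<otimes> R) \<otimes> I\<close>, says that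
  the right action is associative, that the actions commute, and that the left action is
  associative (\<open>mult_assoc_iff\<close>). Its unit laws are those of \<open>l\<close> and \<open>k\<close>
  (\<open>mult_lunit_iff\<close>, \<open>mult_runit_iff\<close>).

  Restricting to summands is legitimate because \<open>- \<otimes> Y\<close> preserves pushouts and \<open>- \<otimes> Y\<close>,
  \<open>Y \<otimes> -\<close> preserve the initial object: closedness gives the statements about \<open>- \<otimes> Y\<close>, and the
  braiding the one about \<open>Y \<otimes> -\<close>. The same preservation makes the associator and the unitors of
  the pushout product well-defined.
\<close>

section \<open>Finite colimits from bicompleteness\<close>

text \<open>The shape of a span if \<open>y \<noteq> z\<close> and of a parallel pair if \<open>y = z\<close>, so that one
computation yields both pushouts and coequalizers. Objects serve as their own identities, and a
composite contains at most one of \<open>p\<close>, \<open>q\<close>.\<close>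

definition two_arrows :: "'u \<Rightarrow> 'u \<Rightarrow> 'u \<Rightarrow> 'u \<Rightarrow> 'u \<Rightarrow> ('u, 'u) cat" where
  "two_arrows x y z p q = \<lparr>
    Ob = {x, y, z},
    Ar = {x, y, z, p, q},
    Dom = (\<lambda>u. if u = p \<or> u = q then x else u),
    Cod = (\<lambda>u. if u = p then y else if u = q then z else u),
    Idt = (\<lambda>u. u),
    Cmp = (\<lambda>v u. if v = p \<or> v = q then v else u)\<rparr>"

lemma category_two_arrows:
  assumes "x \<notin> {y, z}" "p \<notin> {x, y, z}" "q \<notin> {x, y, z}" "p \<noteq> q"
  shows "category (two_arrows x y z p q)"
  using assms by unfold_locales (auto simp: two_arrows_def hom_def split: if_splits)

context category
begin

lemma in_hom_iff: "f \<in> hom C X Y \<longleftrightarrow> f \<in> Ar C \<and> Dom C f = X \<and> Cod C f = Y"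
  by (auto simp: hom_def)

lemma arr_in_hom: "f \<in> Ar C \<Longrightarrow> f \<in> hom C (Dom C f) (Cod C f)"
  by (simp add: in_hom_iff)

lemma Idt_simps:
  assumes "X \<in> Ob C"
  shows "Idt C X \<in> Ar C" "Dom C (Idt C X) = X" "Cod C (Idt C X) = X"
  using Idt_hom[OF assms] by (auto simp: in_hom_iff)

lemma Cmp_simps:
  assumes "f \<in> Ar C" "g \<in> Ar C" "Cod C f = Dom C g"
  shows "g \<cdot> f \<in> Ar C" "Dom C (g \<cdot> f) = Dom C f" "Cod C (g \<cdot> f) = Cod C g"
  using Cmp_hom[OF arr_in_hom[OF assms(1)], of g "Cod C g"] assms by (auto simp: in_hom_iff)

lemma Cmp_assoc_arr:
  assumes "f \<in> Ar C" "g \<in> Ar C" "h \<in> Ar C" "Cod C f = Dom C g" "Cod C g = Dom C h"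
  shows "(h \<cdot> g) \<cdot> f = h \<cdot> (g \<cdot> f)"
  by (rule Cmp_assoc) (use assms in \<open>auto simp: in_hom_iff\<close>)

lemma Cmp_Idt_arr: "f \<in> Ar C \<Longrightarrow> Dom C f = X \<Longrightarrow> f \<cdot> Idt C X = f"
  by (rule Cmp_Idt) (auto simp: in_hom_iff)

lemma Idt_Cmp_arr: "f \<in> Ar C \<Longrightarrow> Cod C f = X \<Longrightarrow> Idt C X \<cdot> f = f"
  by (rule Idt_Cmp) (auto simp: in_hom_iff)

lemmas arr_simps = in_hom_iff Dom_closed Cod_closed Idt_simps Cmp_simps
  Cmp_assoc_arr Cmp_Idt_arr Idt_Cmp_arr

text \<open>A cocone on the diagram is determined by its components at \<open>y\<close> and \<open>z\<close>, the one at \<open>x\<close>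
being a composite. When \<open>y = z\<close> the two components are one and the same, which the implications
from \<open>y = z\<close> record.\<close>

lemma two_arrows_colimit:
  fixes x y z p q :: 'u
  assumes colim: "bicomplete TYPE('u) C"
    and shape: "x \<notin> {y, z}" "p \<notin> {x, y, z}" "q \<notin> {x, y, z}" "p \<noteq> q"
    and arr: "f \<in> Ar C" "g \<in> Ar C" "Dom C f = Dom C g"
    and eq: "y = z \<Longrightarrow> Cod C f = Cod C g"
  shows "\<exists>L i j. i \<in> hom C (Cod C f) L \<and> j \<in> hom C (Cod C g) L \<and> i \<cdot> f = j \<cdot> g \<and>
    (y = z \<longrightarrow> i = j) \<and>
    (\<forall>X u v. u \<in> hom C (Cod C f) X \<and> v \<in> hom C (Cod C g) X \<and> u \<cdot> f = v \<cdot> g \<and>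
      (y = z \<longrightarrow> u = v) \<longrightarrow> (\<exists>!h. h \<in> hom C L X \<and> h \<cdot> i = u \<and> h \<cdot> j = v))"
proof -
  let ?J = "two_arrows x y z p q"
  define F0 where "F0 a = (if a = x then Dom C f else if a = y then Cod C f else Cod C g)" for a
  define F1 where "F1 a = (if a = p then f else if a = q then g else Idt C (F0 a))" for a
  have cat: "category ?J"
    by (rule category_two_arrows) (use shape in auto)
  have F0: "F0 x = Dom C f" "F0 y = Cod C f" "F0 z = Cod C g"
    using shape eq by (auto simp: F0_def)
  have F1: "F1 p = f" "F1 q = g" "F1 x = Idt C (F0 x)" "F1 y = Idt C (F0 y)" "F1 z = Idt C (F0 z)"
    using shape by (auto simp: F1_def)
  have "is_functor ?J C F0 F1"
    unfolding is_functor_def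
    using shape arr eq by (auto simp: two_arrows_def F0 F1 arr_simps split: if_splits)
  then obtain L i where Li: "is_colimit ?J C F0 F1 L i"
    using colim cat unfolding bicomplete_def by blast
  have cocone: "is_cocone ?J C F0 F1 X c \<longleftrightarrow> X \<in> Ob C \<and> c x \<in> hom C (F0 x) X \<and>
      c y \<in> hom C (F0 y) X \<and> c z \<in> hom C (F0 z) X \<and> c y \<cdot> f = c x \<and> c z \<cdot> g = c x" for X c
    unfolding is_cocone_def
    using shape arr by (auto simp: two_arrows_def F1 arr_simps)
  have i: "L \<in> Ob C" "i y \<in> hom C (Cod C f) L" "i z \<in> hom C (Cod C g) L"
      "i y \<cdot> f = i x" "i z \<cdot> g = i x"
    using Li F0 by (auto simp: is_colimit_def cocone)
  have "\<exists>!h. h \<in> hom C L X \<and> h \<cdot> i y = u \<and> h \<cdot> i z = v"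
    if uv: "u \<in> hom C (Cod C f) X" "v \<in> hom C (Cod C g) X" "u \<cdot> f = v \<cdot> g" "y = z \<longrightarrow> u = v"
    for X u v
  proof -
    define c where "c a = (if a = x then u \<cdot> f else if a = y then u else v)" for a
    have c: "c x = u \<cdot> f" "c y = u" "c z = v"
      using shape uv by (auto simp: c_def)
    have "is_cocone ?J C F0 F1 X c"
      unfolding cocone using uv arr by (auto simp: c F0 arr_simps)
    then have "\<exists>!h. h \<in> hom C L X \<and> (\<forall>a \<in> Ob ?J. h \<cdot> i a = c a)"
      using Li by (auto simp: is_colimit_def)
    moreover have "(h \<in> hom C L X \<and> (\<forall>a \<in> Ob ?J. h \<cdot> i a = c a)) \<longleftrightarrow>
        (h \<in> hom C L X \<and> h \<cdot> i y = u \<and> h \<cdot> i z = v)" for h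
    proof -
      have "h \<cdot> i x = u \<cdot> f" if "h \<in> hom C L X" "h \<cdot> i y = u"
      proof -
        have "h \<cdot> (i y \<cdot> f) = u \<cdot> f"
          using that i(2) arr Cmp_assoc_arr[of f "i y" h] by (auto simp: in_hom_iff)
        then show ?thesis by (simp add: i)
      qed
      then show ?thesis by (auto simp: two_arrows_def c)
    qed
    ultimately show ?thesis by simp
  qed
  then show ?thesis
    using i by (intro exI[of _ L] exI[of _ "i y"] exI[of _ "i z"]) auto
qed

lemma has_initial:
  assumes "bicomplete TYPE('u) C"
  shows "\<exists>Z. is_initial C Z"
proof -
  define J :: "('u, 'u) cat" where
    "J = \<lparr>Ob = {}, Ar = {}, Dom = (\<lambda>u. u), Cod = (\<lambda>u. u), Idt = (\<lambda>u. u), Cmp = (\<lambda>v u. u)\<rparr>"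
  have "category J"
    by unfold_locales (auto simp: J_def hom_def)
  moreover have "is_functor J C F0 F1" for F0 F1
    by (simp add: is_functor_def J_def)
  ultimately obtain L i where "is_colimit J C undefined undefined L i"
    using assms unfolding bicomplete_def by blast
  then have "is_initial C L"
    by (auto simp: is_colimit_def is_cocone_def is_initial_def J_def)
  then show ?thesis ..
qed

lemma has_pushouts:
  assumes "infinite (UNIV :: 'u set)" "bicomplete TYPE('u) C"
    and arr: "f \<in> Ar C" "g \<in> Ar C" "Dom C f = Dom C g"
  shows "\<exists>i j. is_pushout C f g i j"
proof -
  obtain d :: "nat \<Rightarrow> 'u" where "inj d"
    using infinite_countable_subset[OF assms(1)] by auto
  then have d: "d m = d n \<longleftrightarrow> m = n" for m n
    by (simp add: inj_eq)
  have "\<exists>L i j. i \<in> hom C (Cod C f) L \<and> j \<in> hom C (Cod C g) L \<and> i \<cdot> f = j \<cdot> g \<and>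
    (d 1 = d 2 \<longrightarrow> i = j) \<and>
    (\<forall>X u v. u \<in> hom C (Cod C f) X \<and> v \<in> hom C (Cod C g) X \<and> u \<cdot> f = v \<cdot> g \<and>
      (d 1 = d 2 \<longrightarrow> u = v) \<longrightarrow> (\<exists>!h. h \<in> hom C L X \<and> h \<cdot> i = u \<and> h \<cdot> j = v))"
    by (rule two_arrows_colimit[where x = "d 0" and p = "d 3" and q = "d 4"])
      (use assms d in auto)
  then obtain L i j where ij: "i \<in> hom C (Cod C f) L" "j \<in> hom C (Cod C g) L" "i \<cdot> f = j \<cdot> g"
    "\<And>X u v. u \<in> hom C (Cod C f) X \<Longrightarrow> v \<in> hom C (Cod C g) X \<Longrightarrow> u \<cdot> f = v \<cdot> g \<Longrightarrow>
      \<exists>!h. h \<in> hom C L X \<and> h \<cdot> i = u \<and> h \<cdot> j = v"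
    unfolding d by auto
  moreover have "Cod C i = L" using ij(1) by (simp add: in_hom_iff)
  ultimately have "is_pushout C f g i j"
    using arr unfolding is_pushout_def by (auto simp: in_hom_iff)
  then show ?thesis by blast
qed

lemma has_coequalizers:
  assumes "infinite (UNIV :: 'u set)" "bicomplete TYPE('u) C"
    and arr: "f \<in> Ar C" "g \<in> Ar C" "Dom C f = Dom C g" "Cod C f = Cod C g"
  shows "\<exists>q. is_coequalizer C f g q"
proof -
  obtain d :: "nat \<Rightarrow> 'u" where "inj d"
    using infinite_countable_subset[OF assms(1)] by auto
  then have d: "d m = d n \<longleftrightarrow> m = n" for m n
    by (simp add: inj_eq)
  have "\<exists>L i j. i \<in> hom C (Cod C f) L \<and> j \<in> hom C (Cod C g) L \<and> i \<cdot> f = j \<cdot> g \<and>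
    (d 1 = d 1 \<longrightarrow> i = j) \<and>
    (\<forall>X u v. u \<in> hom C (Cod C f) X \<and> v \<in> hom C (Cod C g) X \<and> u \<cdot> f = v \<cdot> g \<and>
      (d 1 = d 1 \<longrightarrow> u = v) \<longrightarrow> (\<exists>!h. h \<in> hom C L X \<and> h \<cdot> i = u \<and> h \<cdot> j = v))"
    by (rule two_arrows_colimit[where x = "d 0" and p = "d 3" and q = "d 4"])
      (use assms d in auto)
  then obtain L q where q: "q \<in> hom C (Cod C f) L" "q \<cdot> f = q \<cdot> g"
    "\<And>X u. u \<in> hom C (Cod C f) X \<Longrightarrow> u \<cdot> f = u \<cdot> g \<Longrightarrow>
      \<exists>!h. h \<in> hom C L X \<and> h \<cdot> q = u"
    unfolding arr(4) by auto
  moreover have "Cod C q = L" using q(1) by (simp add: in_hom_iff)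
  ultimately have "is_coequalizer C f g q"
    using arr unfolding is_coequalizer_def by (auto simp: in_hom_iff)
  then show ?thesis by blast
qed

lemma is_pushoutD:
  assumes "is_pushout C f g i j"
  shows "f \<in> Ar C" "g \<in> Ar C" "i \<in> Ar C" "j \<in> Ar C" "Dom C i = Cod C f" "Dom C j = Cod C g"
    "Cod C j = Cod C i" "i \<cdot> f = j \<cdot> g" "Dom C f = Dom C g"
    and "u \<in> hom C (Cod C f) X \<Longrightarrow> v \<in> hom C (Cod C g) X \<Longrightarrow> u \<cdot> f = v \<cdot> g \<Longrightarrow>
      \<exists>!h. h \<in> hom C (Cod C i) X \<and> h \<cdot> i = u \<and> h \<cdot> j = v"
  by (use assms in \<open>unfold is_pushout_def, metis\<close>)+

lemma pushout_jointly_epic: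
  assumes "is_pushout C f g i j" and "u \<in> Ar C" "v \<in> Ar C"
    "Dom C u = Cod C i" "Dom C v = Cod C i" and "u \<cdot> i = v \<cdot> i" "u \<cdot> j = v \<cdot> j"
  shows "u = v"
proof -
  note P = is_pushoutD(1-9)[OF assms(1)] and univ = is_pushoutD(10)[OF assms(1)]
  have "Cod C v = Cod C u"
    using Cmp_simps(3)[of i u] Cmp_simps(3)[of i v] assms P by simp
  then show ?thesis
    using univ[of "u \<cdot> i" "Cod C u" "u \<cdot> j"] assms P by (auto simp: arr_simps)
qed

lemma copair_simps:
  assumes "is_pushout C f g (fst p) (snd p)"
    and "u \<in> Ar C" "v \<in> Ar C" "Dom C u = Cod C f" "Dom C v = Cod C g" "Cod C u = Cod C v"
    and "u \<cdot> f = v \<cdot> g"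
  shows "copair C p u v \<in> Ar C" "Dom C (copair C p u v) = Cod C (fst p)"
    "Cod C (copair C p u v) = Cod C u"
    "copair C p u v \<cdot> fst p = u" "copair C p u v \<cdot> snd p = v"
proof -
  have "\<exists>!h. h \<in> hom C (Cod C (fst p)) (Cod C u) \<and> h \<cdot> fst p = u \<and> h \<cdot> snd p = v"
    by (rule is_pushoutD(10)[OF assms(1)]) (use assms in \<open>auto simp: in_hom_iff\<close>)
  then have "copair C p u v \<in> hom C (Cod C (fst p)) (Cod C u) \<and>
      copair C p u v \<cdot> fst p = u \<and> copair C p u v \<cdot> snd p = v"
    unfolding copair_def by (rule theI')
  then show "copair C p u v \<in> Ar C" "Dom C (copair C p u v) = Cod C (fst p)"
    "Cod C (copair C p u v) = Cod C u"
    "copair C p u v \<cdot> fst p = u" "copair C p u v \<cdot> snd p = v"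
    by (auto simp: in_hom_iff)
qed

end

section \<open>Tensor products of arrows\<close>

context monoidal_category
begin

lemma Tens_simps:
  assumes "f \<in> Ar C" "g \<in> Ar C"
  shows "f \<otimes> g \<in> Ar C" "Dom C (f \<otimes> g) = Dom C f \<otimes>\<^sub>o Dom C g"
    "Cod C (f \<otimes> g) = Cod C f \<otimes>\<^sub>o Cod C g"
  using Tens_hom[OF arr_in_hom[OF assms(1)] arr_in_hom[OF assms(2)]] by (auto simp: in_hom_iff)

lemma interchange:
  assumes "f \<in> Ar C" "f' \<in> Ar C" "g \<in> Ar C" "g' \<in> Ar C" "Cod C f = Dom C f'" "Cod C g = Dom C g'"
  shows "(f' \<otimes> g') \<cdot> (f \<otimes> g) = (f' \<cdot> f) \<otimes> (g' \<cdot> g)"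
  by (rule Tens_Cmp[symmetric]) (use assms in \<open>auto simp: in_hom_iff\<close>)

lemma interchange_Cmp:
  assumes "f \<in> Ar C" "f' \<in> Ar C" "g \<in> Ar C" "g' \<in> Ar C" "Cod C f = Dom C f'" "Cod C g = Dom C g'"
    and "h \<in> Ar C" "Cod C h = Dom C f \<otimes>\<^sub>o Dom C g"
  shows "(f' \<otimes> g') \<cdot> (f \<otimes> g) \<cdot> h = ((f' \<cdot> f) \<otimes> (g' \<cdot> g)) \<cdot> h"
  using Cmp_assoc_arr[of h "f \<otimes> g" "f' \<otimes> g'"] assms by (simp add: Tens_simps interchange)

lemma Assoc_simps:
  assumes "X \<in> Ob C" "Y \<in> Ob C" "Z \<in> Ob C"
  shows "Assoc C X Y Z \<in> Ar C" "Dom C (Assoc C X Y Z) = (X \<otimes>\<^sub>o Y) \<otimes>\<^sub>o Z"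
    "Cod C (Assoc C X Y Z) = X \<otimes>\<^sub>o (Y \<otimes>\<^sub>o Z)"
  using Assoc_hom[OF assms] by (auto simp: in_hom_iff)

lemma Assoc_natural_arr:
  assumes "f \<in> Ar C" "g \<in> Ar C" "h \<in> Ar C" "Cod C f = X" "Cod C g = Y" "Cod C h = Z"
  shows "Assoc C X Y Z \<cdot> ((f \<otimes> g) \<otimes> h) =
    (f \<otimes> (g \<otimes> h)) \<cdot> Assoc C (Dom C f) (Dom C g) (Dom C h)"
  by (rule Assoc_natural) (use assms in \<open>auto simp: in_hom_iff\<close>)

lemma Lunit_simps:
  assumes "X \<in> Ob C"
  shows "Lunit C X \<in> Ar C" "Dom C (Lunit C X) = Unt C \<otimes>\<^sub>o X" "Cod C (Lunit C X) = X"
  using Lunit_hom[OF assms] by (auto simp: in_hom_iff)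

lemma Runit_simps:
  assumes "X \<in> Ob C"
  shows "Runit C X \<in> Ar C" "Dom C (Runit C X) = X \<otimes>\<^sub>o Unt C" "Cod C (Runit C X) = X"
  using Runit_hom[OF assms] by (auto simp: in_hom_iff)

lemmas tens_simps = arr_simps Tens_ob_closed Tens_simps interchange interchange_Cmp Tens_Idt
  Unt_closed Assoc_simps Assoc_natural_arr Lunit_simps Runit_simps

end

context closed_symmetric_monoidal_category
begin

text \<open>A left adjoint preserves colimits: maps out of \<open>W \<otimes> Y\<close> correspond to maps from \<open>W\<close> to the
internal hom, naturally in \<open>W\<close>, and there the universal property of the given pushout applies.\<close>

lemma Tens_preserves_pushout:
  assumes po: "is_pushout C f g i j" and Y: "Y \<in> Ob C"
  shows "is_pushout C (f \<otimes> Idt C Y) (g \<otimes> Idt C Y) (i \<otimes> Idt C Y) (j \<otimes> Idt C Y)"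
proof -
  note P = is_pushoutD(1-9)[OF po] and univ = is_pushoutD(10)[OF po]
  have "\<exists>!h. h \<in> hom C (Cod C i \<otimes>\<^sub>o Y) X \<and> h \<cdot> (i \<otimes> Idt C Y) = u \<and> h \<cdot> (j \<otimes> Idt C Y) = v"
    if uv: "u \<in> hom C (Cod C f \<otimes>\<^sub>o Y) X" "v \<in> hom C (Cod C g \<otimes>\<^sub>o Y) X"
      "u \<cdot> (f \<otimes> Idt C Y) = v \<cdot> (g \<otimes> Idt C Y)" for X u v
  proof -
    have X: "X \<in> Ob C" using uv(1) by (auto simp: arr_simps)
    obtain H ev where H: "H \<in> Ob C" "ev \<in> hom C (H \<otimes>\<^sub>o Y) X"
      and curry: "\<And>W w. W \<in> Ob C \<Longrightarrow> w \<in> hom C (W \<otimes>\<^sub>o Y) X \<Longrightarrow>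
        \<exists>!w'. w' \<in> hom C W H \<and> ev \<cdot> (w' \<otimes> Idt C Y) = w"
      using internal_hom[OF Y X] by blast
    have curry_inject: "w1 = w2"
      if "w1 \<in> hom C W H" "w2 \<in> hom C W H" "ev \<cdot> (w1 \<otimes> Idt C Y) = ev \<cdot> (w2 \<otimes> Idt C Y)" for W w1 w2
    proof -
      have "W \<in> Ob C" using that by (auto simp: arr_simps)
      moreover have "ev \<cdot> (w1 \<otimes> Idt C Y) \<in> hom C (W \<otimes>\<^sub>o Y) X"
        using that H Y by (auto simp: tens_simps)
      ultimately show ?thesis using curry that by metis
    qed
    have split: "(ev \<cdot> (w \<otimes> Idt C Y)) \<cdot> (a \<otimes> Idt C Y) = ev \<cdot> ((w \<cdot> a) \<otimes> Idt C Y)"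
      if "w \<in> Ar C" "Cod C w = H" "a \<in> Ar C" "Cod C a = Dom C w" for w a
      using that H Y by (auto simp: tens_simps)
    obtain u' where u': "u' \<in> hom C (Cod C f) H" "ev \<cdot> (u' \<otimes> Idt C Y) = u"
      using curry[of "Cod C f" u] uv P by (auto simp: arr_simps)
    obtain v' where v': "v' \<in> hom C (Cod C g) H" "ev \<cdot> (v' \<otimes> Idt C Y) = v"
      using curry[of "Cod C g" v] uv P by (auto simp: arr_simps)
    have "u' \<cdot> f = v' \<cdot> g"
    proof (rule curry_inject[where W = "Dom C f"])
      show "ev \<cdot> ((u' \<cdot> f) \<otimes> Idt C Y) = ev \<cdot> ((v' \<cdot> g) \<otimes> Idt C Y)"
        using uv(3) split[of u' f] split[of v' g] u' v' P by (auto simp: in_hom_iff)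
    qed (use u' v' P in \<open>auto simp: arr_simps\<close>)
    then obtain h' where h': "h' \<in> hom C (Cod C i) H" "h' \<cdot> i = u'" "h' \<cdot> j = v'"
      using univ[OF u'(1) v'(1)] by auto
    show ?thesis
    proof (rule ex1I[of _ "ev \<cdot> (h' \<otimes> Idt C Y)"], intro conjI)
      show "ev \<cdot> (h' \<otimes> Idt C Y) \<in> hom C (Cod C i \<otimes>\<^sub>o Y) X"
        using h' H Y by (auto simp: tens_simps)
      show "(ev \<cdot> (h' \<otimes> Idt C Y)) \<cdot> (i \<otimes> Idt C Y) = u" "(ev \<cdot> (h' \<otimes> Idt C Y)) \<cdot> (j \<otimes> Idt C Y) = v"
        using split[of h' i] split[of h' j] h' P u' v' by (auto simp: in_hom_iff)
    next
      fix k
      assume k: "k \<in> hom C (Cod C i \<otimes>\<^sub>o Y) X \<and> k \<cdot> (i \<otimes> Idt C Y) = u \<and> k \<cdot> (j \<otimes> Idt C Y) = v"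
      then obtain k' where k': "k' \<in> hom C (Cod C i) H" "ev \<cdot> (k' \<otimes> Idt C Y) = k"
        using curry[of "Cod C i" k] P by (auto simp: arr_simps)
      have "k' \<cdot> i = h' \<cdot> i"
        by (rule curry_inject[where W = "Dom C i"])
          (use split[of k' i] k k' h' u' P in \<open>auto simp: arr_simps\<close>)
      moreover have "k' \<cdot> j = h' \<cdot> j"
        by (rule curry_inject[where W = "Dom C j"])
          (use split[of k' j] k k' h' v' P in \<open>auto simp: arr_simps\<close>)
      ultimately have "k' = h'"
        using pushout_jointly_epic[OF po, of k' h'] k' h' by (auto simp: in_hom_iff)
      then show "k = ev \<cdot> (h' \<otimes> Idt C Y)" using k' by simp
    qed
  qed
  moreover have "(i \<otimes> Idt C Y) \<cdot> (f \<otimes> Idt C Y) = (j \<otimes> Idt C Y) \<cdot> (g \<otimes> Idt C Y)"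
    using P Y by (simp add: tens_simps)
  ultimately show ?thesis
    using P Y unfolding is_pushout_def by (auto simp: tens_simps)
qed

lemma Tens_initial_left:
  assumes Z: "is_initial C Z" and Y: "Y \<in> Ob C"
  shows "is_initial C (Z \<otimes>\<^sub>o Y)"
proof -
  have "\<exists>!h. h \<in> hom C (Z \<otimes>\<^sub>o Y) X" if X: "X \<in> Ob C" for X
  proof -
    obtain H ev where H: "H \<in> Ob C" "ev \<in> hom C (H \<otimes>\<^sub>o Y) X"
      and curry: "\<And>W w. W \<in> Ob C \<Longrightarrow> w \<in> hom C (W \<otimes>\<^sub>o Y) X \<Longrightarrow>
        \<exists>!w'. w' \<in> hom C W H \<and> ev \<cdot> (w' \<otimes> Idt C Y) = w"
      using internal_hom[OF Y X] by blast
    obtain h where h: "h \<in> hom C Z H" "\<And>k. k \<in> hom C Z H \<Longrightarrow> k = h"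
      using Z H unfolding is_initial_def by blast
    show ?thesis
    proof (rule ex1I[of _ "ev \<cdot> (h \<otimes> Idt C Y)"])
      show "ev \<cdot> (h \<otimes> Idt C Y) \<in> hom C (Z \<otimes>\<^sub>o Y) X"
        using h(1) H Y by (auto simp: tens_simps)
      show "k = ev \<cdot> (h \<otimes> Idt C Y)" if "k \<in> hom C (Z \<otimes>\<^sub>o Y) X" for k
        using curry[of Z k] that h Z unfolding is_initial_def by metis
    qed
  qed
  then show ?thesis
    using Z Y unfolding is_initial_def by (auto simp: Tens_ob_closed)
qed

text \<open>The braiding is an isomorphism from \<open>Y \<otimes> Z\<close> to the initial object \<open>Z \<otimes> Y\<close>.\<close>

lemma Tens_initial_right:
  assumes Z: "is_initial C Z" and Y: "Y \<in> Ob C"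
  shows "is_initial C (Y \<otimes>\<^sub>o Z)"
proof -
  have Z': "Z \<in> Ob C" using Z by (simp add: is_initial_def)
  have B: "Braid C Y Z \<in> hom C (Y \<otimes>\<^sub>o Z) (Z \<otimes>\<^sub>o Y)" "Braid C Z Y \<in> hom C (Z \<otimes>\<^sub>o Y) (Y \<otimes>\<^sub>o Z)"
    "Braid C Z Y \<cdot> Braid C Y Z = Idt C (Y \<otimes>\<^sub>o Z)"
    using Y Z' by (auto simp: Braid_hom Braid_Braid)
  have "\<exists>!h. h \<in> hom C (Y \<otimes>\<^sub>o Z) X" if X: "X \<in> Ob C" for X
  proof -
    obtain h where h: "h \<in> hom C (Z \<otimes>\<^sub>o Y) X" "\<And>k. k \<in> hom C (Z \<otimes>\<^sub>o Y) X \<Longrightarrow> k = h"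
      using Tens_initial_left[OF Z Y] X unfolding is_initial_def by blast
    show ?thesis
    proof (rule ex1I[of _ "h \<cdot> Braid C Y Z"])
      show "h \<cdot> Braid C Y Z \<in> hom C (Y \<otimes>\<^sub>o Z) X"
        by (rule Cmp_hom[OF B(1) h(1)])
    next
      fix k assume k: "k \<in> hom C (Y \<otimes>\<^sub>o Z) X"
      have "k = k \<cdot> Braid C Z Y \<cdot> Braid C Y Z"
        by (simp add: B(3) Cmp_Idt[OF k])
      also have "\<dots> = (k \<cdot> Braid C Z Y) \<cdot> Braid C Y Z"
        by (rule Cmp_assoc[OF B(1) B(2) k, symmetric])
      also have "k \<cdot> Braid C Z Y = h"
        by (rule h(2)) (rule Cmp_hom[OF B(2) k])
      finally show "k = h \<cdot> Braid C Y Z" .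
    qed
  qed
  then show ?thesis
    using Z' Y unfolding is_initial_def by (auto simp: Tens_ob_closed)
qed

end

section \<open>The pushout product\<close>

text \<open>The colimits are required by their universal properties and not as colimits of diagrams, so that
the type bounding the size of diagrams disappears.\<close>

locale finitely_cocomplete_closed_category = closed_symmetric_monoidal_category C
  for C :: "('o, 'm, 'x) symmoncat_scheme" (structure) +
  assumes initial_exists: "\<exists>Z. is_initial C Z"
    and pushout_exists: "f \<in> Ar C \<Longrightarrow> g \<in> Ar C \<Longrightarrow> Dom C f = Dom C g \<Longrightarrow> \<exists>i j. is_pushout C f g i j"
    and coequalizer_exists: "f \<in> Ar C \<Longrightarrow> g \<in> Ar C \<Longrightarrow> Dom C f = Dom C g \<Longrightarrow> Cod C f = Cod C g \<Longrightarrow>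
      \<exists>q. is_coequalizer C f g q"
begin

lemma initial_is_initial: "is_initial C (initial C)"
  unfolding initial_def by (rule someI_ex[OF initial_exists])

lemma initial_Ob: "initial C \<in> Ob C"
  using initial_is_initial by (simp add: is_initial_def)

lemma from_initial_hom: "X \<in> Ob C \<Longrightarrow> from_initial C X \<in> hom C (initial C) X"
  using theI'[of "\<lambda>h. h \<in> hom C (initial C) X"] initial_is_initial
  by (simp add: from_initial_def is_initial_def)

lemma is_initial_unique:
  "is_initial C Z \<Longrightarrow> u \<in> hom C Z X \<Longrightarrow> v \<in> hom C Z X \<Longrightarrow> u = v"
  unfolding is_initial_def by (metis Cod_closed in_hom_iff)

lemma pp_unit_simps:
  "pp_unit C \<in> Ar C" "Dom C (pp_unit C) = initial C" "Cod C (pp_unit C) = Unt C"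
  using from_initial_hom[OF Unt_closed] by (auto simp: pp_unit_def in_hom_iff)

lemma pp_pushout:
  assumes "f \<in> Ar C" "g \<in> Ar C"
  shows "is_pushout C (Idt C (Dom C f) \<otimes> g) (f \<otimes> Idt C (Dom C g)) (pp_in1 C f g) (pp_in2 C f g)"
proof -
  have "\<exists>p. is_pushout C (Idt C (Dom C f) \<otimes> g) (f \<otimes> Idt C (Dom C g)) (fst p) (snd p)"
    using pushout_exists[of "Idt C (Dom C f) \<otimes> g" "f \<otimes> Idt C (Dom C g)"] assms
    by (simp add: tens_simps)
  then show ?thesis
    unfolding pp_cocone_def pushout_def by (rule someI_ex)
qed

lemma pp_copair:
  assumes "f \<in> Ar C" "g \<in> Ar C" "u \<in> Ar C" "v \<in> Ar C" "Dom C u = Dom C f \<otimes>\<^sub>o Cod C g"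
    "Dom C v = Cod C f \<otimes>\<^sub>o Dom C g" "Cod C u = Cod C v"
    and "u \<cdot> (Idt C (Dom C f) \<otimes> g) = v \<cdot> (f \<otimes> Idt C (Dom C g))"
  shows "copair C (pp_cocone C f g) u v \<in> Ar C"
    "Dom C (copair C (pp_cocone C f g) u v) = Cod C (pp_in1 C f g)"
    "Cod C (copair C (pp_cocone C f g) u v) = Cod C u"
    "copair C (pp_cocone C f g) u v \<cdot> pp_in1 C f g = u"
    "copair C (pp_cocone C f g) u v \<cdot> pp_in2 C f g = v"
  using copair_simps[OF pp_pushout[OF assms(1,2)], of u v] assms by (simp_all add: tens_simps)

lemma pp_simps:
  assumes "f \<in> Ar C" "g \<in> Ar C"
  shows "pp_ob C f g \<in> Ar C" "Cod C (pp_ob C f g) = Cod C f \<otimes>\<^sub>o Cod C g"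
    "pp_in1 C f g \<in> Ar C" "Dom C (pp_in1 C f g) = Dom C f \<otimes>\<^sub>o Cod C g"
    "Cod C (pp_in1 C f g) = Dom C (pp_ob C f g)"
    "pp_in2 C f g \<in> Ar C" "Dom C (pp_in2 C f g) = Cod C f \<otimes>\<^sub>o Dom C g"
    "Cod C (pp_in2 C f g) = Dom C (pp_ob C f g)"
    "pp_ob C f g \<cdot> pp_in1 C f g = f \<otimes> Idt C (Cod C g)"
    "pp_ob C f g \<cdot> pp_in2 C f g = Idt C (Cod C f) \<otimes> g"
  using is_pushoutD(1-9)[OF pp_pushout[OF assms]] assms
    pp_copair[OF assms, of "f \<otimes> Idt C (Cod C g)" "Idt C (Cod C f) \<otimes> g"]
  by (simp_all add: tens_simps pp_ob_def)

lemma pp_square: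
  assumes "f \<in> Ar C" "g \<in> Ar C"
  shows "pp_in1 C f g \<cdot> (Idt C (Dom C f) \<otimes> g) = pp_in2 C f g \<cdot> (f \<otimes> Idt C (Dom C g))"
  by (rule is_pushoutD(8)[OF pp_pushout[OF assms]])

lemma pp_square_Cmp:
  assumes "f \<in> Ar C" "g \<in> Ar C" "w \<in> Ar C" "Cod C w = Dom C f \<otimes>\<^sub>o Dom C g"
  shows "pp_in1 C f g \<cdot> (Idt C (Dom C f) \<otimes> g) \<cdot> w = pp_in2 C f g \<cdot> (f \<otimes> Idt C (Dom C g)) \<cdot> w"
proof -
  have "(pp_in1 C f g \<cdot> (Idt C (Dom C f) \<otimes> g)) \<cdot> w =
      (pp_in2 C f g \<cdot> (f \<otimes> Idt C (Dom C g))) \<cdot> w"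
    using pp_square assms by simp
  then show ?thesis using assms by (simp add: tens_simps pp_simps)
qed

lemma pp_jointly_epic:
  assumes "f \<in> Ar C" "g \<in> Ar C" "u \<in> Ar C" "v \<in> Ar C"
    "Dom C u = Dom C (pp_ob C f g)" "Dom C v = Dom C (pp_ob C f g)"
    and "u \<cdot> pp_in1 C f g = v \<cdot> pp_in1 C f g" "u \<cdot> pp_in2 C f g = v \<cdot> pp_in2 C f g"
  shows "u = v"
  by (rule pushout_jointly_epic[OF pp_pushout[OF assms(1,2)]]) (use assms in \<open>simp_all add: pp_simps\<close>)

lemma pp_Tens_jointly_epic:
  assumes "f \<in> Ar C" "g \<in> Ar C" "Z \<in> Ob C" "u \<in> Ar C" "v \<in> Ar C"
    "Dom C u = Dom C (pp_ob C f g) \<otimes>\<^sub>o Z" "Dom C v = Dom C (pp_ob C f g) \<otimes>\<^sub>o Z"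
    and "u \<cdot> (pp_in1 C f g \<otimes> Idt C Z) = v \<cdot> (pp_in1 C f g \<otimes> Idt C Z)"
    "u \<cdot> (pp_in2 C f g \<otimes> Idt C Z) = v \<cdot> (pp_in2 C f g \<otimes> Idt C Z)"
  shows "u = v"
  by (rule pushout_jointly_epic[OF Tens_preserves_pushout[OF pp_pushout[OF assms(1,2)] assms(3)]])
    (use assms in \<open>simp_all add: tens_simps pp_simps\<close>)

text \<open>The domain of \<open>(f \<box> g) \<box> h\<close> is covered by \<open>(X\<^sub>0 \<otimes> Y\<^sub>1) \<otimes> Z\<^sub>1\<close>, \<open>(X\<^sub>1 \<otimes> Y\<^sub>0) \<otimes> Z\<^sub>1\<close> and
\<open>(X\<^sub>1 \<otimes> Y\<^sub>1) \<otimes> Z\<^sub>0\<close>: the first two cover the domain of \<open>(f \<box> g) \<otimes> Z\<^sub>1\<close>, since tensoring with \<open>Z\<^sub>1\<close>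
preserves the pushout defining \<open>f \<box> g\<close>.\<close>

lemma pp_jointly_epic3:
  assumes fgh: "f \<in> Ar C" "g \<in> Ar C" "h \<in> Ar C" and uv: "u \<in> Ar C" "v \<in> Ar C"
    "Dom C u = Dom C (pp_ob C (pp_ob C f g) h)" "Dom C v = Dom C (pp_ob C (pp_ob C f g) h)"
    and "u \<cdot> pp_in1 C (pp_ob C f g) h \<cdot> (pp_in1 C f g \<otimes> Idt C (Cod C h)) =
      v \<cdot> pp_in1 C (pp_ob C f g) h \<cdot> (pp_in1 C f g \<otimes> Idt C (Cod C h))"
    "u \<cdot> pp_in1 C (pp_ob C f g) h \<cdot> (pp_in2 C f g \<otimes> Idt C (Cod C h)) =
      v \<cdot> pp_in1 C (pp_ob C f g) h \<cdot> (pp_in2 C f g \<otimes> Idt C (Cod C h))"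
    "u \<cdot> pp_in2 C (pp_ob C f g) h = v \<cdot> pp_in2 C (pp_ob C f g) h"
  shows "u = v"
proof (rule pp_jointly_epic[of "pp_ob C f g" h])
  show "u \<cdot> pp_in1 C (pp_ob C f g) h = v \<cdot> pp_in1 C (pp_ob C f g) h"
    by (rule pp_Tens_jointly_epic[of f g "Cod C h"])
      (use assms in \<open>simp_all add: tens_simps pp_simps\<close>)
qed (use assms in \<open>simp_all add: pp_simps\<close>)

lemma square_eq_iff:
  "s = t \<longleftrightarrow> sq_src s = sq_src t \<and> sq_tgt s = sq_tgt t \<and> sq_top s = sq_top t \<and> sq_bot s = sq_bot t"
  by (cases s; cases t) simp

lemma pp_square_sel:
  "sq_src (pp_map C s s') = pp_ob C (sq_src s) (sq_src s')"
  "sq_tgt (pp_map C s s') = pp_ob C (sq_tgt s) (sq_tgt s')"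
  "sq_bot (pp_map C s s') = sq_bot s \<otimes> sq_bot s'"
  "sq_src (pp_assoc C f g h) = pp_ob C (pp_ob C f g) h"
  "sq_tgt (pp_assoc C f g h) = pp_ob C f (pp_ob C g h)"
  "sq_bot (pp_assoc C f g h) = Assoc C (Cod C f) (Cod C g) (Cod C h)"
  "sq_src (pp_lunit C f) = pp_ob C (pp_unit C) f" "sq_tgt (pp_lunit C f) = f"
  "sq_bot (pp_lunit C f) = Lunit C (Cod C f)"
  "sq_src (pp_runit C f) = pp_ob C f (pp_unit C)" "sq_tgt (pp_runit C f) = f"
  "sq_bot (pp_runit C f) = Runit C (Cod C f)"
  by (simp_all add: pp_map_def pp_assoc_def pp_lunit_def pp_runit_def Let_def)

lemma Arr_pp_sel:
  "Ob (Arr_pp C) = Ar C" "Idt (Arr_pp C) f = Square f f (Idt C (Dom C f)) (Idt C (Cod C f))"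
  "s' \<cdot>\<^bsub>Arr_pp C\<^esub> s = Square (sq_src s) (sq_tgt s') (sq_top s' \<cdot> sq_top s) (sq_bot s' \<cdot> sq_bot s)"
  "Tens_ob (Arr_pp C) = pp_ob C" "Tens (Arr_pp C) = pp_map C" "Unt (Arr_pp C) = pp_unit C"
  "Assoc (Arr_pp C) = pp_assoc C" "Lunit (Arr_pp C) = pp_lunit C" "Runit (Arr_pp C) = pp_runit C"
  by (simp_all add: Arr_pp_def Arr_def)

lemma Arr_pp_hom_iff:
  "s \<in> hom (Arr_pp C) f g \<longleftrightarrow> f \<in> Ar C \<and> g \<in> Ar C \<and> sq_src s = f \<and> sq_tgt s = g \<and>
    sq_top s \<in> hom C (Dom C f) (Dom C g) \<and> sq_bot s \<in> hom C (Cod C f) (Cod C g) \<and>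
    g \<cdot> sq_top s = sq_bot s \<cdot> f"
  by (auto simp: Arr_pp_def Arr_def hom_def)

lemma Idt_square_hom: "f \<in> Ar C \<Longrightarrow> Square f f (Idt C (Dom C f)) (Idt C (Cod C f)) \<in> hom (Arr_pp C) f f"
  by (simp add: Arr_pp_hom_iff arr_simps)

text \<open>Every pair of components is a square, as both ways around it start from the initial object.\<close>

lemma unit_square_hom:
  assumes f: "f \<in> Ar C" and z: "z \<in> hom C (initial C) (Dom C f)" and e: "e \<in> hom C (Unt C) (Cod C f)"
  shows "Square (pp_unit C) f z e \<in> hom (Arr_pp C) (pp_unit C) f"
proof -
  have "f \<cdot> z = e \<cdot> pp_unit C"
    by (rule is_initial_unique[OF initial_is_initial])
      (use f z e in \<open>auto simp: arr_simps pp_unit_simps\<close>)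
  then show ?thesis
    using f z e by (simp add: Arr_pp_hom_iff pp_unit_simps)
qed

lemma pp_map_simps:
  assumes s: "s \<in> hom (Arr_pp C) f f'" and t: "t \<in> hom (Arr_pp C) g g'"
  shows "sq_top (pp_map C s t) \<in> Ar C"
    "Dom C (sq_top (pp_map C s t)) = Dom C (pp_ob C f g)"
    "Cod C (sq_top (pp_map C s t)) = Dom C (pp_ob C f' g')"
    "sq_top (pp_map C s t) \<cdot> pp_in1 C f g = pp_in1 C f' g' \<cdot> (sq_top s \<otimes> sq_bot t)"
    "sq_top (pp_map C s t) \<cdot> pp_in2 C f g = pp_in2 C f' g' \<cdot> (sq_bot s \<otimes> sq_top t)"
proof -
  note s = s[unfolded Arr_pp_hom_iff in_hom_iff] and t = t[unfolded Arr_pp_hom_iff in_hom_iff]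
  let ?u = "pp_in1 C f' g' \<cdot> (sq_top s \<otimes> sq_bot t)"
  let ?v = "pp_in2 C f' g' \<cdot> (sq_bot s \<otimes> sq_top t)"
  have fg: "f \<in> Ar C" "g \<in> Ar C" using s t by auto
  have "?u \<cdot> (Idt C (Dom C f) \<otimes> g) =
      pp_in1 C f' g' \<cdot> (Idt C (Dom C f') \<otimes> g') \<cdot> (sq_top s \<otimes> sq_top t)"
    using s t by (simp add: tens_simps pp_simps)
  also have "\<dots> = pp_in2 C f' g' \<cdot> (f' \<otimes> Idt C (Dom C g')) \<cdot> (sq_top s \<otimes> sq_top t)"
    by (rule pp_square_Cmp) (use s t in \<open>simp_all add: tens_simps\<close>)
  also have "\<dots> = ?v \<cdot> (f \<otimes> Idt C (Dom C g))"
    using s t by (simp add: tens_simps pp_simps)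
  finally have eq: "?u \<cdot> (Idt C (Dom C f) \<otimes> g) = ?v \<cdot> (f \<otimes> Idt C (Dom C g))" .
  have "sq_top (pp_map C s t) = copair C (pp_cocone C f g) ?u ?v"
    using s t by (simp add: pp_map_def Let_def)
  then show "sq_top (pp_map C s t) \<in> Ar C"
    "Dom C (sq_top (pp_map C s t)) = Dom C (pp_ob C f g)"
    "Cod C (sq_top (pp_map C s t)) = Dom C (pp_ob C f' g')"
    "sq_top (pp_map C s t) \<cdot> pp_in1 C f g = ?u"
    "sq_top (pp_map C s t) \<cdot> pp_in2 C f g = ?v"
    using pp_copair[OF fg _ _ _ _ _ eq] s t by (simp_all add: tens_simps pp_simps)
qed

text \<open>The three prescribed maps \<open>u1\<close>, \<open>u2\<close>, \<open>u3\<close> are glued in two stages: \<open>u1\<close> and \<open>u2\<close> to a map \<open>s\<close>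
on \<open>(dom (f \<box> g)) \<otimes> Z\<^sub>1\<close>, then \<open>s\<close> and \<open>u3\<close>. Every compatibility follows from naturality of the
associator and one of the squares defining \<open>f \<box> (g \<box> h)\<close> and \<open>g \<box> h\<close>.\<close>

lemma pp_assoc_exists:
  assumes fgh: "f \<in> Ar C" "g \<in> Ar C" "h \<in> Ar C"
  \<comment> \<open>The abbreviation hides the associator from the simplifier, whose naturality is applied by hand.\<close>
  defines "A X Y Z \<equiv> Assoc C X Y Z"
  shows "\<exists>t. t \<in> hom C (Dom C (pp_ob C (pp_ob C f g) h)) (Dom C (pp_ob C f (pp_ob C g h))) \<and>
    t \<cdot> pp_in1 C (pp_ob C f g) h \<cdot> (pp_in1 C f g \<otimes> Idt C (Cod C h)) =
      pp_in1 C f (pp_ob C g h) \<cdot> A (Dom C f) (Cod C g) (Cod C h) \<and>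
    t \<cdot> pp_in1 C (pp_ob C f g) h \<cdot> (pp_in2 C f g \<otimes> Idt C (Cod C h)) =
      pp_in2 C f (pp_ob C g h) \<cdot> (Idt C (Cod C f) \<otimes> pp_in1 C g h) \<cdot>
        A (Cod C f) (Dom C g) (Cod C h) \<and>
    t \<cdot> pp_in2 C (pp_ob C f g) h =
      pp_in2 C f (pp_ob C g h) \<cdot> (Idt C (Cod C f) \<otimes> pp_in2 C g h) \<cdot>
        A (Cod C f) (Cod C g) (Dom C h)"
proof -
  let ?X0 = "Dom C f" and ?X1 = "Cod C f" and ?Y0 = "Dom C g" and ?Y1 = "Cod C g"
  let ?Z0 = "Dom C h" and ?Z1 = "Cod C h"
  let ?fg = "pp_ob C f g" and ?gh = "pp_ob C g h"
  define a1 a2 b1 b2 where "a1 = pp_in1 C f g" and "a2 = pp_in2 C f g"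
    and "b1 = pp_in1 C g h" and "b2 = pp_in2 C g h"
  define c1 c2 d1 d2 where "c1 = pp_in1 C f ?gh" and "c2 = pp_in2 C f ?gh"
    and "d1 = pp_in1 C ?fg h" and "d2 = pp_in2 C ?fg h"
  note in_defs = a1_def a2_def b1_def b2_def c1_def c2_def d1_def d2_def
  have in_simps:
    "a1 \<in> Ar C" "Dom C a1 = ?X0 \<otimes>\<^sub>o ?Y1" "Cod C a1 = Dom C ?fg"
    "a2 \<in> Ar C" "Dom C a2 = ?X1 \<otimes>\<^sub>o ?Y0" "Cod C a2 = Dom C ?fg"
    "b1 \<in> Ar C" "Dom C b1 = ?Y0 \<otimes>\<^sub>o ?Z1" "Cod C b1 = Dom C ?gh"
    "b2 \<in> Ar C" "Dom C b2 = ?Y1 \<otimes>\<^sub>o ?Z0" "Cod C b2 = Dom C ?gh"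
    "c1 \<in> Ar C" "Dom C c1 = ?X0 \<otimes>\<^sub>o ?Y1 \<otimes>\<^sub>o ?Z1" "Cod C c1 = Dom C (pp_ob C f ?gh)"
    "c2 \<in> Ar C" "Dom C c2 = ?X1 \<otimes>\<^sub>o Dom C ?gh" "Cod C c2 = Dom C (pp_ob C f ?gh)"
    "d1 \<in> Ar C" "Dom C d1 = Dom C ?fg \<otimes>\<^sub>o ?Z1" "Cod C d1 = Dom C (pp_ob C ?fg h)"
    "d2 \<in> Ar C" "Dom C d2 = (?X1 \<otimes>\<^sub>o ?Y1) \<otimes>\<^sub>o ?Z0" "Cod C d2 = Dom C (pp_ob C ?fg h)"
    "?fg \<cdot> a1 = f \<otimes> Idt C ?Y1" "?fg \<cdot> a2 = Idt C ?X1 \<otimes> g"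
    "?gh \<cdot> b1 = g \<otimes> Idt C ?Z1" "?gh \<cdot> b2 = Idt C ?Y1 \<otimes> h"
    "?fg \<in> Ar C" "?gh \<in> Ar C" "Cod C ?fg = ?X1 \<otimes>\<^sub>o ?Y1" "Cod C ?gh = ?Y1 \<otimes>\<^sub>o ?Z1"
    using fgh by (simp_all add: in_defs pp_simps)
  have A_simps: "A X Y Z \<in> Ar C" "Dom C (A X Y Z) = (X \<otimes>\<^sub>o Y) \<otimes>\<^sub>o Z" "Cod C (A X Y Z) = X \<otimes>\<^sub>o Y \<otimes>\<^sub>o Z"
    if "X \<in> Ob C" "Y \<in> Ob C" "Z \<in> Ob C" for X Y Z
    using that by (simp_all add: A_def Assoc_simps)
  have A_nat: "A (Cod C p) (Cod C q) (Cod C r) \<cdot> ((p \<otimes> q) \<otimes> r) =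
      (p \<otimes> (q \<otimes> r)) \<cdot> A (Dom C p) (Dom C q) (Dom C r)"
    if "p \<in> Ar C" "q \<in> Ar C" "r \<in> Ar C" for p q r
    unfolding A_def by (rule Assoc_natural_arr) (use that in auto)
  note S = arr_simps Tens_ob_closed Tens_simps interchange interchange_Cmp fgh in_simps A_simps
  define u1 where "u1 = c1 \<cdot> A ?X0 ?Y1 ?Z1"
  define u2 where "u2 = c2 \<cdot> (Idt C ?X1 \<otimes> b1) \<cdot> A ?X1 ?Y0 ?Z1"
  define u3 where "u3 = c2 \<cdot> (Idt C ?X1 \<otimes> b2) \<cdot> A ?X1 ?Y1 ?Z0"
  have u_simps: "u1 \<in> Ar C" "Dom C u1 = (?X0 \<otimes>\<^sub>o ?Y1) \<otimes>\<^sub>o ?Z1" "Cod C u1 = Dom C (pp_ob C f ?gh)"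
    "u2 \<in> Ar C" "Dom C u2 = (?X1 \<otimes>\<^sub>o ?Y0) \<otimes>\<^sub>o ?Z1" "Cod C u2 = Dom C (pp_ob C f ?gh)"
    "u3 \<in> Ar C" "Dom C u3 = (?X1 \<otimes>\<^sub>o ?Y1) \<otimes>\<^sub>o ?Z0" "Cod C u3 = Dom C (pp_ob C f ?gh)"
    by (simp_all add: u1_def u2_def u3_def S)
  \<comment> \<open>The pushout square of \<open>f \<box> (g \<box> h)\<close>, in a form where \<open>b\<close> is a coprojection of \<open>g \<box> h\<close>.\<close>
  have c_square: "c1 \<cdot> (Idt C ?X0 \<otimes> (?gh \<cdot> b)) \<cdot> w = c2 \<cdot> (f \<otimes> b) \<cdot> w"
    if "b \<in> Ar C" "Cod C b = Dom C ?gh" "w \<in> Ar C" "Cod C w = ?X0 \<otimes>\<^sub>o Dom C b" for b w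
  proof -
    have "c1 \<cdot> (Idt C ?X0 \<otimes> ?gh) \<cdot> (Idt C ?X0 \<otimes> b) \<cdot> w =
        c2 \<cdot> (f \<otimes> Idt C (Dom C ?gh)) \<cdot> (Idt C ?X0 \<otimes> b) \<cdot> w"
      unfolding in_defs by (rule pp_square_Cmp) (use that in \<open>simp_all add: S\<close>)
    then show ?thesis using that by (simp add: S)
  qed
  \<comment> \<open>\<open>u1\<close> and \<open>u2\<close> agree on \<open>(X\<^sub>0 \<otimes> Y\<^sub>0) \<otimes> Z\<^sub>1\<close>.\<close>
  have Tens_g: "u1 \<cdot> ((Idt C ?X0 \<otimes> g) \<otimes> Idt C ?Z1) = u2 \<cdot> ((f \<otimes> Idt C ?Y0) \<otimes> Idt C ?Z1)"
  proof -
    have "u1 \<cdot> ((Idt C ?X0 \<otimes> g) \<otimes> Idt C ?Z1) = c1 \<cdot> (Idt C ?X0 \<otimes> (?gh \<cdot> b1)) \<cdot> A ?X0 ?Y0 ?Z1"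
      using A_nat[of "Idt C ?X0" g "Idt C ?Z1"] by (simp add: S u1_def)
    also have "\<dots> = c2 \<cdot> (f \<otimes> b1) \<cdot> A ?X0 ?Y0 ?Z1"
      by (rule c_square) (simp_all add: S)
    also have "\<dots> = u2 \<cdot> ((f \<otimes> Idt C ?Y0) \<otimes> Idt C ?Z1)"
      using A_nat[of f "Idt C ?Y0" "Idt C ?Z1"] by (simp add: S u2_def Tens_Idt)
    finally show ?thesis .
  qed
  have "\<exists>!s. s \<in> hom C (Cod C (a1 \<otimes> Idt C ?Z1)) (Dom C (pp_ob C f ?gh)) \<and>
      s \<cdot> (a1 \<otimes> Idt C ?Z1) = u1 \<and> s \<cdot> (a2 \<otimes> Idt C ?Z1) = u2"
    unfolding a1_def a2_def
    by (rule is_pushoutD(10)[OF Tens_preserves_pushout[OF pp_pushout[OF fgh(1,2)], of "Cod C h"]])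
      (simp_all add: S u_simps Tens_g)
  then obtain s where s: "s \<in> Ar C" "Dom C s = Dom C ?fg \<otimes>\<^sub>o ?Z1" "Cod C s = Dom C (pp_ob C f ?gh)"
      "s \<cdot> (a1 \<otimes> Idt C ?Z1) = u1" "s \<cdot> (a2 \<otimes> Idt C ?Z1) = u2"
    by (auto simp: S)
  have s_h: "s \<cdot> (a \<otimes> h) = (s \<cdot> (a \<otimes> Idt C ?Z1)) \<cdot> (Idt C (Dom C a) \<otimes> h)"
    if "a \<in> Ar C" "Cod C a = Dom C ?fg" for a
    using that s by (simp add: S)
  \<comment> \<open>\<open>s\<close> and \<open>u3\<close> agree on \<open>(dom (f \<box> g)) \<otimes> Z\<^sub>0\<close>, tested on the two summands of its first factor.\<close>
  have Tens_h: "s \<cdot> (Idt C (Dom C ?fg) \<otimes> h) = u3 \<cdot> (?fg \<otimes> Idt C ?Z0)"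
  proof (rule pp_Tens_jointly_epic[of f g ?Z0], unfold a1_def[symmetric] a2_def[symmetric])
    have "(s \<cdot> (Idt C (Dom C ?fg) \<otimes> h)) \<cdot> (a1 \<otimes> Idt C ?Z0) = u1 \<cdot> (Idt C (?X0 \<otimes>\<^sub>o ?Y1) \<otimes> h)"
      using s_h[of a1] s by (simp add: S)
    also have "\<dots> = c1 \<cdot> (Idt C ?X0 \<otimes> (?gh \<cdot> b2)) \<cdot> A ?X0 ?Y1 ?Z0"
      using A_nat[of "Idt C ?X0" "Idt C ?Y1" h] by (simp add: S u1_def Tens_Idt)
    also have "\<dots> = c2 \<cdot> (f \<otimes> b2) \<cdot> A ?X0 ?Y1 ?Z0"
      by (rule c_square) (simp_all add: S)
    also have "\<dots> = u3 \<cdot> ((f \<otimes> Idt C ?Y1) \<otimes> Idt C ?Z0)"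
      using A_nat[of f "Idt C ?Y1" "Idt C ?Z0"] by (simp add: S u3_def Tens_Idt)
    finally show "(s \<cdot> (Idt C (Dom C ?fg) \<otimes> h)) \<cdot> (a1 \<otimes> Idt C ?Z0) =
        (u3 \<cdot> (?fg \<otimes> Idt C ?Z0)) \<cdot> (a1 \<otimes> Idt C ?Z0)"
      by (simp add: S u_simps)
    have "(s \<cdot> (Idt C (Dom C ?fg) \<otimes> h)) \<cdot> (a2 \<otimes> Idt C ?Z0) = u2 \<cdot> (Idt C (?X1 \<otimes>\<^sub>o ?Y0) \<otimes> h)"
      using s_h[of a2] s by (simp add: S)
    also have "\<dots> = c2 \<cdot> (Idt C ?X1 \<otimes> (b1 \<cdot> (Idt C ?Y0 \<otimes> h))) \<cdot> A ?X1 ?Y0 ?Z0"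
      using A_nat[of "Idt C ?X1" "Idt C ?Y0" h] by (simp add: S u2_def Tens_Idt)
    also have "b1 \<cdot> (Idt C ?Y0 \<otimes> h) = b2 \<cdot> (g \<otimes> Idt C ?Z0)"
      unfolding in_defs by (rule pp_square) (fact fgh)+
    also have "c2 \<cdot> (Idt C ?X1 \<otimes> (b2 \<cdot> (g \<otimes> Idt C ?Z0))) \<cdot> A ?X1 ?Y0 ?Z0 =
        u3 \<cdot> ((Idt C ?X1 \<otimes> g) \<otimes> Idt C ?Z0)"
      using A_nat[of "Idt C ?X1" g "Idt C ?Z0"] by (simp add: S u3_def)
    finally show "(s \<cdot> (Idt C (Dom C ?fg) \<otimes> h)) \<cdot> (a2 \<otimes> Idt C ?Z0) =
        (u3 \<cdot> (?fg \<otimes> Idt C ?Z0)) \<cdot> (a2 \<otimes> Idt C ?Z0)"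
      by (simp add: S u_simps)
  qed (simp_all add: S s u_simps)
  define t where "t = copair C (pp_cocone C ?fg h) s u3"
  have t: "t \<in> Ar C" "Dom C t = Cod C d1" "Cod C t = Cod C s" "t \<cdot> d1 = s" "t \<cdot> d2 = u3"
    unfolding t_def d1_def d2_def
    by (rule pp_copair; simp add: S s u_simps Tens_h)+
  have "t \<cdot> d1 \<cdot> w = s \<cdot> w" if "w \<in> Ar C" "Cod C w = Dom C d1" for w
    using Cmp_assoc_arr[of w d1 t] that t by (simp add: S)
  then show ?thesis
    unfolding in_defs[symmetric] u1_def[symmetric] u2_def[symmetric] u3_def[symmetric]
    by (intro exI[of _ t]) (simp add: S t s)
qed

lemma pp_assoc_simps:
  assumes fgh: "f \<in> Ar C" "g \<in> Ar C" "h \<in> Ar C"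
  shows "sq_top (pp_assoc C f g h) \<in> Ar C"
    "Dom C (sq_top (pp_assoc C f g h)) = Dom C (pp_ob C (pp_ob C f g) h)"
    "Cod C (sq_top (pp_assoc C f g h)) = Dom C (pp_ob C f (pp_ob C g h))"
    "sq_top (pp_assoc C f g h) \<cdot> pp_in1 C (pp_ob C f g) h \<cdot> (pp_in1 C f g \<otimes> Idt C (Cod C h)) =
      pp_in1 C f (pp_ob C g h) \<cdot> Assoc C (Dom C f) (Cod C g) (Cod C h)"
    "sq_top (pp_assoc C f g h) \<cdot> pp_in1 C (pp_ob C f g) h \<cdot> (pp_in2 C f g \<otimes> Idt C (Cod C h)) =
      pp_in2 C f (pp_ob C g h) \<cdot> (Idt C (Cod C f) \<otimes> pp_in1 C g h) \<cdot>
        Assoc C (Cod C f) (Dom C g) (Cod C h)"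
    "sq_top (pp_assoc C f g h) \<cdot> pp_in2 C (pp_ob C f g) h =
      pp_in2 C f (pp_ob C g h) \<cdot> (Idt C (Cod C f) \<otimes> pp_in2 C g h) \<cdot>
        Assoc C (Cod C f) (Cod C g) (Dom C h)"
proof -
  let ?P = "\<lambda>t. t \<in> hom C (Dom C (pp_ob C (pp_ob C f g) h)) (Dom C (pp_ob C f (pp_ob C g h))) \<and>
    t \<cdot> pp_in1 C (pp_ob C f g) h \<cdot> (pp_in1 C f g \<otimes> Idt C (Cod C h)) =
      pp_in1 C f (pp_ob C g h) \<cdot> Assoc C (Dom C f) (Cod C g) (Cod C h) \<and>
    t \<cdot> pp_in1 C (pp_ob C f g) h \<cdot> (pp_in2 C f g \<otimes> Idt C (Cod C h)) =
      pp_in2 C f (pp_ob C g h) \<cdot> (Idt C (Cod C f) \<otimes> pp_in1 C g h) \<cdot>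
        Assoc C (Cod C f) (Dom C g) (Cod C h) \<and>
    t \<cdot> pp_in2 C (pp_ob C f g) h =
      pp_in2 C f (pp_ob C g h) \<cdot> (Idt C (Cod C f) \<otimes> pp_in2 C g h) \<cdot>
        Assoc C (Cod C f) (Cod C g) (Dom C h)"
  have "u = v" if "?P u" "?P v" for u v
    by (rule pp_jointly_epic3[OF fgh]) (use that in \<open>simp_all add: in_hom_iff\<close>)
  then have "\<exists>!t. ?P t"
    using pp_assoc_exists[OF fgh] by (intro ex_ex1I) blast+
  then have "?P (sq_top (pp_assoc C f g h))"
    unfolding pp_assoc_def Let_def square.sel by (rule theI')
  then show "sq_top (pp_assoc C f g h) \<in> Ar C"
    "Dom C (sq_top (pp_assoc C f g h)) = Dom C (pp_ob C (pp_ob C f g) h)"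
    "Cod C (sq_top (pp_assoc C f g h)) = Dom C (pp_ob C f (pp_ob C g h))"
    "sq_top (pp_assoc C f g h) \<cdot> pp_in1 C (pp_ob C f g) h \<cdot> (pp_in1 C f g \<otimes> Idt C (Cod C h)) =
      pp_in1 C f (pp_ob C g h) \<cdot> Assoc C (Dom C f) (Cod C g) (Cod C h)"
    "sq_top (pp_assoc C f g h) \<cdot> pp_in1 C (pp_ob C f g) h \<cdot> (pp_in2 C f g \<otimes> Idt C (Cod C h)) =
      pp_in2 C f (pp_ob C g h) \<cdot> (Idt C (Cod C f) \<otimes> pp_in1 C g h) \<cdot>
        Assoc C (Cod C f) (Dom C g) (Cod C h)"
    "sq_top (pp_assoc C f g h) \<cdot> pp_in2 C (pp_ob C f g) h =
      pp_in2 C f (pp_ob C g h) \<cdot> (Idt C (Cod C f) \<otimes> pp_in2 C g h) \<cdot>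
        Assoc C (Cod C f) (Cod C g) (Dom C h)"
    by (simp_all add: in_hom_iff)
qed

text \<open>The other coprojection has the initial domain \<open>0 \<otimes> X\<^sub>1\<close>, so any two maps agree on it.\<close>

lemma pp_unit_left_epic:
  assumes "f \<in> Ar C" "u \<in> Ar C" "v \<in> Ar C" "Dom C u = Dom C (pp_ob C (pp_unit C) f)"
    "Dom C v = Dom C (pp_ob C (pp_unit C) f)"
    and eq: "u \<cdot> pp_in2 C (pp_unit C) f = v \<cdot> pp_in2 C (pp_unit C) f"
  shows "u = v"
proof (rule pp_jointly_epic[of "pp_unit C" f])
  have "is_initial C (initial C \<otimes>\<^sub>o Cod C f)"
    by (rule Tens_initial_left[OF initial_is_initial]) (use assms in \<open>simp add: arr_simps\<close>)
  moreover have "Cod C v = Cod C u"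
    using Cmp_simps(3)[of "pp_in2 C (pp_unit C) f" u] Cmp_simps(3)[of "pp_in2 C (pp_unit C) f" v]
      assms by (simp add: pp_simps pp_unit_simps)
  ultimately show "u \<cdot> pp_in1 C (pp_unit C) f = v \<cdot> pp_in1 C (pp_unit C) f"
    using assms by (intro is_initial_unique) (auto simp: arr_simps pp_simps pp_unit_simps)
qed (use assms pp_unit_simps in auto)

lemma pp_unit_right_epic:
  assumes "f \<in> Ar C" "u \<in> Ar C" "v \<in> Ar C" "Dom C u = Dom C (pp_ob C f (pp_unit C))"
    "Dom C v = Dom C (pp_ob C f (pp_unit C))"
    and eq: "u \<cdot> pp_in1 C f (pp_unit C) = v \<cdot> pp_in1 C f (pp_unit C)"
  shows "u = v"
proof (rule pp_jointly_epic[of f "pp_unit C"])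
  have "is_initial C (Cod C f \<otimes>\<^sub>o initial C)"
    by (rule Tens_initial_right[OF initial_is_initial]) (use assms in \<open>simp add: arr_simps\<close>)
  moreover have "Cod C v = Cod C u"
    using Cmp_simps(3)[of "pp_in1 C f (pp_unit C)" u] Cmp_simps(3)[of "pp_in1 C f (pp_unit C)" v]
      assms by (simp add: pp_simps pp_unit_simps)
  ultimately show "u \<cdot> pp_in2 C f (pp_unit C) = v \<cdot> pp_in2 C f (pp_unit C)"
    using assms by (intro is_initial_unique) (auto simp: arr_simps pp_simps pp_unit_simps)
qed (use assms pp_unit_simps in auto)

text \<open>The unitor is glued from \<open>Lunit\<close> and the unique map out of \<open>0 \<otimes> X\<^sub>1\<close>. They agree on \<open>0 \<otimes> X\<^sub>0\<close>,
which is initial as well.\<close>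

lemma pp_lunit_simps:
  assumes f: "f \<in> Ar C"
  shows "sq_top (pp_lunit C f) \<in> Ar C"
    "Dom C (sq_top (pp_lunit C f)) = Dom C (pp_ob C (pp_unit C) f)"
    "Cod C (sq_top (pp_lunit C f)) = Dom C f"
    "sq_top (pp_lunit C f) \<cdot> pp_in2 C (pp_unit C) f = Lunit C (Dom C f)"
proof -
  let ?P = "\<lambda>t. t \<in> hom C (Dom C (pp_ob C (pp_unit C) f)) (Dom C f) \<and>
    t \<cdot> pp_in2 C (pp_unit C) f = Lunit C (Dom C f)"
  have Ob: "Dom C f \<in> Ob C" "Cod C f \<in> Ob C" using f by (auto simp: arr_simps)
  have init: "is_initial C (initial C \<otimes>\<^sub>o X)" if "X \<in> Ob C" for X
    by (rule Tens_initial_left[OF initial_is_initial that])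
  obtain w where w: "w \<in> hom C (initial C \<otimes>\<^sub>o Cod C f) (Dom C f)"
    using init[OF Ob(2)] Ob(1) unfolding is_initial_def by blast
  have "w \<cdot> (Idt C (initial C) \<otimes> f) = Lunit C (Dom C f) \<cdot> (pp_unit C \<otimes> Idt C (Dom C f))"
    by (rule is_initial_unique[OF init[OF Ob(1)]])
      (use w f Ob in \<open>auto simp: tens_simps pp_unit_simps initial_Ob\<close>)
  then have "?P (copair C (pp_cocone C (pp_unit C) f) w (Lunit C (Dom C f)))"
    using pp_copair[of "pp_unit C" f w "Lunit C (Dom C f)"] w f Ob
    by (simp add: tens_simps pp_simps pp_unit_simps)
  moreover have "u = v" if "?P u" "?P v" for u v
    by (rule pp_unit_left_epic[OF f]) (use that in \<open>simp_all add: in_hom_iff\<close>)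
  ultimately have "\<exists>!t. ?P t" by blast
  then have "?P (sq_top (pp_lunit C f))"
    unfolding pp_lunit_def square.sel by (rule theI')
  then show "sq_top (pp_lunit C f) \<in> Ar C"
    "Dom C (sq_top (pp_lunit C f)) = Dom C (pp_ob C (pp_unit C) f)"
    "Cod C (sq_top (pp_lunit C f)) = Dom C f"
    "sq_top (pp_lunit C f) \<cdot> pp_in2 C (pp_unit C) f = Lunit C (Dom C f)"
    by (simp_all add: in_hom_iff)
qed

lemma pp_runit_simps:
  assumes f: "f \<in> Ar C"
  shows "sq_top (pp_runit C f) \<in> Ar C"
    "Dom C (sq_top (pp_runit C f)) = Dom C (pp_ob C f (pp_unit C))"
    "Cod C (sq_top (pp_runit C f)) = Dom C f"
    "sq_top (pp_runit C f) \<cdot> pp_in1 C f (pp_unit C) = Runit C (Dom C f)"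
proof -
  let ?P = "\<lambda>t. t \<in> hom C (Dom C (pp_ob C f (pp_unit C))) (Dom C f) \<and>
    t \<cdot> pp_in1 C f (pp_unit C) = Runit C (Dom C f)"
  have Ob: "Dom C f \<in> Ob C" "Cod C f \<in> Ob C" using f by (auto simp: arr_simps)
  have init: "is_initial C (X \<otimes>\<^sub>o initial C)" if "X \<in> Ob C" for X
    by (rule Tens_initial_right[OF initial_is_initial that])
  obtain w where w: "w \<in> hom C (Cod C f \<otimes>\<^sub>o initial C) (Dom C f)"
    using init[OF Ob(2)] Ob(1) unfolding is_initial_def by blast
  have "Runit C (Dom C f) \<cdot> (Idt C (Dom C f) \<otimes> pp_unit C) = w \<cdot> (f \<otimes> Idt C (initial C))"
    by (rule is_initial_unique[OF init[OF Ob(1)]])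
      (use w f Ob in \<open>auto simp: tens_simps pp_unit_simps initial_Ob\<close>)
  then have "?P (copair C (pp_cocone C f (pp_unit C)) (Runit C (Dom C f)) w)"
    using pp_copair[of f "pp_unit C" "Runit C (Dom C f)" w] w f Ob
    by (simp add: tens_simps pp_simps pp_unit_simps)
  moreover have "u = v" if "?P u" "?P v" for u v
    by (rule pp_unit_right_epic[OF f]) (use that in \<open>simp_all add: in_hom_iff\<close>)
  ultimately have "\<exists>!t. ?P t" by blast
  then have "?P (sq_top (pp_runit C f))"
    unfolding pp_runit_def square.sel by (rule theI')
  then show "sq_top (pp_runit C f) \<in> Ar C"
    "Dom C (sq_top (pp_runit C f)) = Dom C (pp_ob C f (pp_unit C))"
    "Cod C (sq_top (pp_runit C f)) = Dom C f"
    "sq_top (pp_runit C f) \<cdot> pp_in1 C f (pp_unit C) = Runit C (Dom C f)"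
    by (simp_all add: in_hom_iff)
qed


section \<open>Monoids in the arrow category\<close>

lemma mult_square_iff:
  assumes j: "j \<in> Ar C" and "t \<in> hom C (Dom C (pp_ob C j j)) (Dom C j)"
    and "m \<in> hom C (Cod C j \<otimes>\<^sub>o Cod C j) (Cod C j)"
  shows "j \<cdot> t = m \<cdot> pp_ob C j j \<longleftrightarrow>
    j \<cdot> t \<cdot> pp_in1 C j j = m \<cdot> (j \<otimes> Idt C (Cod C j)) \<and>
    j \<cdot> t \<cdot> pp_in2 C j j = m \<cdot> (Idt C (Cod C j) \<otimes> j)"
    (is "_ \<longleftrightarrow> ?R")
proof -
  have restrict: "(j \<cdot> t) \<cdot> pp_in1 C j j = j \<cdot> t \<cdot> pp_in1 C j j"
    "(m \<cdot> pp_ob C j j) \<cdot> pp_in1 C j j = m \<cdot> (j \<otimes> Idt C (Cod C j))"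
    "(j \<cdot> t) \<cdot> pp_in2 C j j = j \<cdot> t \<cdot> pp_in2 C j j"
    "(m \<cdot> pp_ob C j j) \<cdot> pp_in2 C j j = m \<cdot> (Idt C (Cod C j) \<otimes> j)"
    using assms by (simp_all add: tens_simps pp_simps)
  show ?thesis
  proof
    assume "j \<cdot> t = m \<cdot> pp_ob C j j"
    then show ?R using restrict by simp
  next
    assume R: ?R
    show "j \<cdot> t = m \<cdot> pp_ob C j j"
      by (rule pp_jointly_epic[OF j j]) (use assms restrict R in \<open>simp_all add: tens_simps pp_simps\<close>)
  qed
qed

text \<open>Both sides are maps out of the domain of \<open>(j \<box> j) \<box> j\<close>, so they are equal iff they agree on its
three summands. Each summand contributes one of the associativity laws for the actions.\<close>

lemma mult_assoc_iff:
  fixes j t m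
  defines "\<mu> \<equiv> Square (pp_ob C j j) j t m" and "\<iota> \<equiv> Idt (Arr_pp C) j"
    and "R \<equiv> Cod C j" and "I \<equiv> Dom C j" and "k \<equiv> t \<cdot> pp_in1 C j j" and "l \<equiv> t \<cdot> pp_in2 C j j"
  assumes j: "j \<in> Ar C" and t: "t \<in> hom C (Dom C (pp_ob C j j)) (Dom C j)"
    and m: "m \<in> hom C (Cod C j \<otimes>\<^sub>o Cod C j) (Cod C j)" and square: "j \<cdot> t = m \<cdot> pp_ob C j j"
  shows "t \<cdot> sq_top (pp_map C \<mu> \<iota>) = t \<cdot> sq_top (pp_map C \<iota> \<mu>) \<cdot> sq_top (pp_assoc C j j j) \<longleftrightarrow>
    k \<cdot> (k \<otimes> Idt C R) = k \<cdot> (Idt C I \<otimes> m) \<cdot> Assoc C I R R \<and>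
    k \<cdot> (l \<otimes> Idt C R) = l \<cdot> (Idt C R \<otimes> k) \<cdot> Assoc C R I R \<and>
    l \<cdot> (m \<otimes> Idt C I) = l \<cdot> (Idt C R \<otimes> l) \<cdot> Assoc C R R I"
proof -
  have \<iota>: "\<iota> = Square j j (Idt C I) (Idt C R)"
    by (simp add: \<iota>_def I_def R_def Arr_pp_sel)
  have \<iota>_hom: "\<iota> \<in> hom (Arr_pp C) j j"
    unfolding \<iota> I_def R_def by (rule Idt_square_hom[OF j])
  have \<mu>_hom: "\<mu> \<in> hom (Arr_pp C) (pp_ob C j j) j"
    using j t m square by (simp add: \<mu>_def Arr_pp_hom_iff pp_simps)
  have ob: "R \<in> Ob C" "I \<in> Ob C" using j by (auto simp: R_def I_def arr_simps)
  let ?i1 = "pp_in1 C j j" and ?i2 = "pp_in2 C j j" and ?jj = "pp_ob C j j"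
  define p where "p = sq_top (pp_map C \<mu> \<iota>)"
  define q where "q = sq_top (pp_map C \<iota> \<mu>)"
  define a where "a = sq_top (pp_assoc C j j j)"
  have jR: "Cod C j = R" and jI: "Dom C j = I"
    by (simp_all add: R_def I_def)
  note base = j t[unfolded jI in_hom_iff] m[unfolded jR in_hom_iff] ob jR jI
  note in_simps = pp_simps[OF j j, unfolded jR jI]
  have kl: "k \<in> hom C (I \<otimes>\<^sub>o R) I" "l \<in> hom C (R \<otimes>\<^sub>o I) I"
    using base by (simp_all add: k_def l_def arr_simps in_simps)
  have p: "p \<in> Ar C" "Dom C p = Dom C (pp_ob C ?jj j)" "Cod C p = Dom C ?jj"
    "p \<cdot> pp_in1 C ?jj j = ?i1 \<cdot> (t \<otimes> Idt C R)" "p \<cdot> pp_in2 C ?jj j = ?i2 \<cdot> (m \<otimes> Idt C I)"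
    using pp_map_simps[OF \<mu>_hom \<iota>_hom] by (simp_all add: p_def \<mu>_def \<iota>)
  have q: "q \<in> Ar C" "Dom C q = Dom C (pp_ob C j ?jj)" "Cod C q = Dom C ?jj"
    "q \<cdot> pp_in1 C j ?jj = ?i1 \<cdot> (Idt C I \<otimes> m)" "q \<cdot> pp_in2 C j ?jj = ?i2 \<cdot> (Idt C R \<otimes> t)"
    using pp_map_simps[OF \<iota>_hom \<mu>_hom] by (simp_all add: q_def \<mu>_def \<iota>)
  note a = pp_assoc_simps[OF j j j, folded a_def, unfolded jR jI]
  note out_simps = pp_simps[of ?jj j, unfolded jR jI] pp_simps[of j ?jj, unfolded jR jI]
  note S = tens_simps base in_simps out_simps
  have t1: "t \<cdot> ?i1 \<cdot> w = k \<cdot> w" if "w \<in> Ar C" "Cod C w = I \<otimes>\<^sub>o R" for w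
    using that base by (simp add: k_def arr_simps in_simps)
  have t2: "t \<cdot> ?i2 \<cdot> w = l \<cdot> w" if "w \<in> Ar C" "Cod C w = R \<otimes>\<^sub>o I" for w
    using that base by (simp add: l_def arr_simps in_simps)
  have p1: "p \<cdot> pp_in1 C ?jj j \<cdot> w = ?i1 \<cdot> (t \<otimes> Idt C R) \<cdot> w"
    if "w \<in> Ar C" "Cod C w = Dom C ?jj \<otimes>\<^sub>o R" for w
    using Cmp_assoc_arr[of w "pp_in1 C ?jj j" p] p that by (simp add: S)
  have q1: "q \<cdot> pp_in1 C j ?jj \<cdot> w = ?i1 \<cdot> (Idt C I \<otimes> m) \<cdot> w"
    if "w \<in> Ar C" "Cod C w = I \<otimes>\<^sub>o (R \<otimes>\<^sub>o R)" for w
    using Cmp_assoc_arr[of w "pp_in1 C j ?jj" q] q that by (simp add: S)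
  have q2: "q \<cdot> pp_in2 C j ?jj \<cdot> w = ?i2 \<cdot> (Idt C R \<otimes> t) \<cdot> w"
    if "w \<in> Ar C" "Cod C w = R \<otimes>\<^sub>o Dom C ?jj" for w
    using Cmp_assoc_arr[of w "pp_in2 C j ?jj" q] q that by (simp add: S)
  have lhs: "(t \<cdot> p) \<cdot> pp_in1 C ?jj j \<cdot> (?i1 \<otimes> Idt C R) = k \<cdot> (k \<otimes> Idt C R)"
    "(t \<cdot> p) \<cdot> pp_in1 C ?jj j \<cdot> (?i2 \<otimes> Idt C R) = k \<cdot> (l \<otimes> Idt C R)"
    "(t \<cdot> p) \<cdot> pp_in2 C ?jj j = l \<cdot> (m \<otimes> Idt C I)"
    using kl by (simp_all add: S p p1 t1 t2 flip: k_def l_def)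
  have rhs: "(t \<cdot> q \<cdot> a) \<cdot> pp_in1 C ?jj j \<cdot> (?i1 \<otimes> Idt C R) = k \<cdot> (Idt C I \<otimes> m) \<cdot> Assoc C I R R"
    "(t \<cdot> q \<cdot> a) \<cdot> pp_in1 C ?jj j \<cdot> (?i2 \<otimes> Idt C R) = l \<cdot> (Idt C R \<otimes> k) \<cdot> Assoc C R I R"
    "(t \<cdot> q \<cdot> a) \<cdot> pp_in2 C ?jj j = l \<cdot> (Idt C R \<otimes> l) \<cdot> Assoc C R R I"
    using kl by (simp_all add: S q q1 q2 a t1 t2 flip: k_def l_def)
  have "t \<cdot> p \<in> Ar C" "t \<cdot> q \<cdot> a \<in> Ar C" "Dom C (t \<cdot> p) = Dom C (pp_ob C ?jj j)"
    "Dom C (t \<cdot> q \<cdot> a) = Dom C (pp_ob C ?jj j)"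
    using base p q a(1-3) by (simp_all add: arr_simps)
  note epic = pp_jointly_epic3[OF j j j this, unfolded jR lhs rhs]
  have "t \<cdot> p = t \<cdot> q \<cdot> a \<longleftrightarrow>
    k \<cdot> (k \<otimes> Idt C R) = k \<cdot> (Idt C I \<otimes> m) \<cdot> Assoc C I R R \<and>
    k \<cdot> (l \<otimes> Idt C R) = l \<cdot> (Idt C R \<otimes> k) \<cdot> Assoc C R I R \<and>
    l \<cdot> (m \<otimes> Idt C I) = l \<cdot> (Idt C R \<otimes> l) \<cdot> Assoc C R R I"
    using epic lhs rhs by metis
  then show ?thesis
    unfolding p_def q_def a_def .
qed

lemma mult_lunit_iff:
  fixes j t z e
  defines "\<eta> \<equiv> Square (pp_unit C) j z e"
  assumes j: "j \<in> Ar C" and t: "t \<in> hom C (Dom C (pp_ob C j j)) (Dom C j)"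
    and z: "z \<in> hom C (initial C) (Dom C j)" and e: "e \<in> hom C (Unt C) (Cod C j)"
  shows "t \<cdot> sq_top (pp_map C \<eta> (Idt (Arr_pp C) j)) = sq_top (pp_lunit C j) \<longleftrightarrow>
    (t \<cdot> pp_in2 C j j) \<cdot> (e \<otimes> Idt C (Dom C j)) = Lunit C (Dom C j)"
proof -
  define p where "p = sq_top (pp_map C \<eta> (Idt (Arr_pp C) j))"
  have p: "p \<in> Ar C" "Dom C p = Dom C (pp_ob C (pp_unit C) j)" "Cod C p = Dom C (pp_ob C j j)"
    "p \<cdot> pp_in2 C (pp_unit C) j = pp_in2 C j j \<cdot> (e \<otimes> Idt C (Dom C j))"
    using pp_map_simps[OF unit_square_hom[OF j z e] Idt_square_hom[OF j]]
    by (simp_all add: p_def \<eta>_def Arr_pp_sel)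
  have "t \<cdot> p = sq_top (pp_lunit C j) \<longleftrightarrow>
      (t \<cdot> p) \<cdot> pp_in2 C (pp_unit C) j = sq_top (pp_lunit C j) \<cdot> pp_in2 C (pp_unit C) j"
    using pp_unit_left_epic[OF j, of "t \<cdot> p" "sq_top (pp_lunit C j)"] p t pp_lunit_simps[OF j]
    by (auto simp: arr_simps)
  also have "(t \<cdot> p) \<cdot> pp_in2 C (pp_unit C) j = (t \<cdot> pp_in2 C j j) \<cdot> (e \<otimes> Idt C (Dom C j))"
    using p t e j by (simp add: tens_simps pp_simps pp_unit_simps)
  finally show ?thesis
    by (simp add: p_def pp_lunit_simps[OF j])
qed

lemma mult_runit_iff:
  fixes j t z e
  defines "\<eta> \<equiv> Square (pp_unit C) j z e"
  assumes j: "j \<in> Ar C" and t: "t \<in> hom C (Dom C (pp_ob C j j)) (Dom C j)"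
    and z: "z \<in> hom C (initial C) (Dom C j)" and e: "e \<in> hom C (Unt C) (Cod C j)"
  shows "t \<cdot> sq_top (pp_map C (Idt (Arr_pp C) j) \<eta>) = sq_top (pp_runit C j) \<longleftrightarrow>
    (t \<cdot> pp_in1 C j j) \<cdot> (Idt C (Dom C j) \<otimes> e) = Runit C (Dom C j)"
proof -
  define p where "p = sq_top (pp_map C (Idt (Arr_pp C) j) \<eta>)"
  have p: "p \<in> Ar C" "Dom C p = Dom C (pp_ob C j (pp_unit C))" "Cod C p = Dom C (pp_ob C j j)"
    "p \<cdot> pp_in1 C j (pp_unit C) = pp_in1 C j j \<cdot> (Idt C (Dom C j) \<otimes> e)"
    using pp_map_simps[OF Idt_square_hom[OF j] unit_square_hom[OF j z e]]
    by (simp_all add: p_def \<eta>_def Arr_pp_sel)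
  have "t \<cdot> p = sq_top (pp_runit C j) \<longleftrightarrow>
      (t \<cdot> p) \<cdot> pp_in1 C j (pp_unit C) = sq_top (pp_runit C j) \<cdot> pp_in1 C j (pp_unit C)"
    using pp_unit_right_epic[OF j, of "t \<cdot> p" "sq_top (pp_runit C j)"] p t pp_runit_simps[OF j]
    by (auto simp: arr_simps)
  also have "(t \<cdot> p) \<cdot> pp_in1 C j (pp_unit C) = (t \<cdot> pp_in1 C j j) \<cdot> (Idt C (Dom C j) \<otimes> e)"
    using p t e j by (simp add: tens_simps pp_simps pp_unit_simps)
  finally show ?thesis
    by (simp add: p_def pp_runit_simps[OF j])
qed

text \<open>The bottom components of the monoid laws are the monoid laws for \<open>R\<close>. The top components
give the module laws for the restrictions of \<open>t\<close> to the two summands.\<close>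

lemma is_smith_ideal_iff:
  assumes j: "j \<in> Ar C" and t: "t \<in> hom C (Dom C (pp_ob C j j)) (Dom C j)"
    and m: "m \<in> hom C (Cod C j \<otimes>\<^sub>o Cod C j) (Cod C j)"
    and z: "z \<in> hom C (initial C) (Dom C j)" and e: "e \<in> hom C (Unt C) (Cod C j)"
  defines "R \<equiv> \<lparr>mon_ob = Cod C j, mon_mult = m, mon_unit = e\<rparr>"
    and "I \<equiv> \<lparr>bm_ob = Dom C j, bm_lact = t \<cdot> pp_in2 C j j, bm_ract = t \<cdot> pp_in1 C j j\<rparr>"
  shows "is_smith_ideal C \<lparr>mon_ob = j, mon_mult = Square (pp_ob C j j) j t m,
      mon_unit = Square (pp_unit C) j z e\<rparr> \<longleftrightarrow>
    is_monoid C R \<and> is_bimodule C R I \<and> is_bimodule_map C R I (regular_bimodule R) j"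
proof -
  let ?\<mu> = "Square (pp_ob C j j) j t m" and ?\<eta> = "Square (pp_unit C) j z e"
  let ?\<iota> = "Idt (Arr_pp C) j"
  have ob: "Cod C j \<in> Ob C" "Dom C j \<in> Ob C" using j by (auto simp: arr_simps)
  have mult: "?\<mu> \<in> hom (Arr_pp C) (pp_ob C j j) j \<longleftrightarrow> j \<cdot> t = m \<cdot> pp_ob C j j"
    using j t m by (simp add: Arr_pp_hom_iff pp_simps)
  have unit: "?\<eta> \<in> hom (Arr_pp C) (pp_unit C) j"
    by (rule unit_square_hom[OF j z e])
  have acts: "t \<cdot> pp_in2 C j j \<in> hom C (Cod C j \<otimes>\<^sub>o Dom C j) (Dom C j)"
    "t \<cdot> pp_in1 C j j \<in> hom C (Dom C j \<otimes>\<^sub>o Cod C j) (Dom C j)"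
    using j t by (auto simp: arr_simps pp_simps)
  have "is_smith_ideal C \<lparr>mon_ob = j, mon_mult = ?\<mu>, mon_unit = ?\<eta>\<rparr> \<longleftrightarrow>
      j \<cdot> t = m \<cdot> pp_ob C j j \<and>
      t \<cdot> sq_top (pp_map C ?\<mu> ?\<iota>) = t \<cdot> sq_top (pp_map C ?\<iota> ?\<mu>) \<cdot> sq_top (pp_assoc C j j j) \<and>
      m \<cdot> (m \<otimes> Idt C (Cod C j)) =
        m \<cdot> (Idt C (Cod C j) \<otimes> m) \<cdot> Assoc C (Cod C j) (Cod C j) (Cod C j) \<and>
      t \<cdot> sq_top (pp_map C ?\<eta> ?\<iota>) = sq_top (pp_lunit C j) \<and>
      m \<cdot> (e \<otimes> Idt C (Cod C j)) = Lunit C (Cod C j) \<and>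
      t \<cdot> sq_top (pp_map C ?\<iota> ?\<eta>) = sq_top (pp_runit C j) \<and>
      m \<cdot> (Idt C (Cod C j) \<otimes> e) = Runit C (Cod C j)"
    using j mult unit unfolding is_smith_ideal_def is_monoid_def Let_def
    by (simp add: Arr_pp_sel square_eq_iff pp_square_sel)
  also have "\<dots> \<longleftrightarrow> is_monoid C R \<and> is_bimodule C R I \<and> is_bimodule_map C R I (regular_bimodule R) j"
    unfolding mult_square_iff[OF j t m] is_monoid_def is_bimodule_def is_bimodule_map_def Let_def
      R_def I_def regular_bimodule_def mon.simps bimod.simps
    using mult_assoc_iff[OF j t m] mult_square_iff[OF j t m]
      mult_lunit_iff[OF j t z e] mult_runit_iff[OF j t z e]
      ob m e acts arr_in_hom[OF j]
    by blast
  finally show ?thesis .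
qed

section \<open>Tensor products over a monoid\<close>

lemma coequalizer_is_coequalizer:
  assumes "f \<in> Ar C" "g \<in> Ar C" "Dom C f = Dom C g" "Cod C f = Cod C g"
  shows "is_coequalizer C f g (coequalizer C f g)"
  unfolding coequalizer_def by (rule someI_ex[OF coequalizer_exists[OF assms]])

lemma bimodule_simps:
  assumes "is_bimodule C R M"
  shows "bm_ob M \<in> Ob C" "bm_lact M \<in> Ar C" "Dom C (bm_lact M) = mon_ob R \<otimes>\<^sub>o bm_ob M"
    "Cod C (bm_lact M) = bm_ob M" "bm_ract M \<in> Ar C" "Dom C (bm_ract M) = bm_ob M \<otimes>\<^sub>o mon_ob R"
    "Cod C (bm_ract M) = bm_ob M"
  using assms unfolding is_bimodule_def Let_def in_hom_iff by blast+

lemma regular_is_bimodule: "is_monoid C R \<Longrightarrow> is_bimodule C R (regular_bimodule R)"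
  unfolding is_monoid_def is_bimodule_def regular_bimodule_def Let_def bimod.simps by blast

lemma tensor_over_induced:
  assumes R: "is_monoid C R" and M: "is_bimodule C R M" and N: "is_bimodule C R N"
    and u: "u \<in> hom C (bm_ob M \<otimes>\<^sub>o bm_ob N) X"
    and bal: "u \<cdot> (bm_ract M \<otimes> Idt C (bm_ob N)) =
      u \<cdot> (Idt C (bm_ob M) \<otimes> bm_lact N) \<cdot> Assoc C (bm_ob M) (mon_ob R) (bm_ob N)"
  shows "\<exists>!h. h \<in> hom C (tensor_over_ob C R M N) X \<and> h \<cdot> tensor_over_proj C R M N = u"
proof -
  have r: "mon_ob R \<in> Ob C" using R unfolding is_monoid_def Let_def by blast
  note S = tens_simps r bimodule_simps[OF M] bimodule_simps[OF N]
  have "is_coequalizer C (bm_ract M \<otimes> Idt C (bm_ob N))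
      ((Idt C (bm_ob M) \<otimes> bm_lact N) \<cdot> Assoc C (bm_ob M) (mon_ob R) (bm_ob N))
      (tensor_over_proj C R M N)"
    unfolding tensor_over_proj_def by (rule coequalizer_is_coequalizer) (simp_all add: S)
  then show ?thesis
    using u bal unfolding is_coequalizer_def tensor_over_ob_def by (simp add: S del: in_hom_iff)
qed

lemma tensor_over_proj_simps:
  assumes R: "is_monoid C R" and M: "is_bimodule C R M" and N: "is_bimodule C R N"
  shows "tensor_over_proj C R M N \<in> hom C (bm_ob M \<otimes>\<^sub>o bm_ob N) (tensor_over_ob C R M N)"
    "tensor_over_proj C R M N \<cdot> (bm_ract M \<otimes> Idt C (bm_ob N)) = tensor_over_proj C R M N \<cdot>
      (Idt C (bm_ob M) \<otimes> bm_lact N) \<cdot> Assoc C (bm_ob M) (mon_ob R) (bm_ob N)"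
proof -
  have r: "mon_ob R \<in> Ob C" using R unfolding is_monoid_def Let_def by blast
  note S = tens_simps r bimodule_simps[OF M] bimodule_simps[OF N]
  have "is_coequalizer C (bm_ract M \<otimes> Idt C (bm_ob N))
      ((Idt C (bm_ob M) \<otimes> bm_lact N) \<cdot> Assoc C (bm_ob M) (mon_ob R) (bm_ob N))
      (tensor_over_proj C R M N)"
    unfolding tensor_over_proj_def by (rule coequalizer_is_coequalizer) (simp_all add: S)
  then show "tensor_over_proj C R M N \<in> hom C (bm_ob M \<otimes>\<^sub>o bm_ob N) (tensor_over_ob C R M N)"
    "tensor_over_proj C R M N \<cdot> (bm_ract M \<otimes> Idt C (bm_ob N)) = tensor_over_proj C R M N \<cdot>
      (Idt C (bm_ob M) \<otimes> bm_lact N) \<cdot> Assoc C (bm_ob M) (mon_ob R) (bm_ob N)"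
    unfolding is_coequalizer_def tensor_over_ob_def by (simp_all add: S)
qed

lemma lact_iso_simps:
  assumes R: "is_monoid C R" and M: "is_bimodule C R M"
  shows "lact_iso C R M \<in> hom C (tensor_over_ob C R (regular_bimodule R) M) (bm_ob M)"
    "lact_iso C R M \<cdot> tensor_over_proj C R (regular_bimodule R) M = bm_lact M"
proof -
  have "\<exists>!h. h \<in> hom C (tensor_over_ob C R (regular_bimodule R) M) (bm_ob M) \<and>
      h \<cdot> tensor_over_proj C R (regular_bimodule R) M = bm_lact M"
    by (rule tensor_over_induced[OF R regular_is_bimodule[OF R] M])
      (use M in \<open>unfold is_bimodule_def Let_def regular_bimodule_def bimod.simps, blast\<close>)+
  from theI'[OF this] show "lact_iso C R M \<in> hom C (tensor_over_ob C R (regular_bimodule R) M) (bm_ob M)"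
    "lact_iso C R M \<cdot> tensor_over_proj C R (regular_bimodule R) M = bm_lact M"
    by (simp_all add: lact_iso_def)
qed

lemma ract_iso_simps:
  assumes R: "is_monoid C R" and M: "is_bimodule C R M"
  shows "ract_iso C R M \<in> hom C (tensor_over_ob C R M (regular_bimodule R)) (bm_ob M)"
    "ract_iso C R M \<cdot> tensor_over_proj C R M (regular_bimodule R) = bm_ract M"
proof -
  have "\<exists>!h. h \<in> hom C (tensor_over_ob C R M (regular_bimodule R)) (bm_ob M) \<and>
      h \<cdot> tensor_over_proj C R M (regular_bimodule R) = bm_ract M"
    by (rule tensor_over_induced[OF R M regular_is_bimodule[OF R]])
      (use M in \<open>unfold is_bimodule_def Let_def regular_bimodule_def bimod.simps, blast\<close>)+
  from theI'[OF this] show "ract_iso C R M \<in> hom C (tensor_over_ob C R M (regular_bimodule R)) (bm_ob M)"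
    "ract_iso C R M \<cdot> tensor_over_proj C R M (regular_bimodule R) = bm_ract M"
    by (simp_all add: ract_iso_def)
qed

lemma Idt_bimodule_map: "is_bimodule C R M \<Longrightarrow> mon_ob R \<in> Ob C \<Longrightarrow> is_bimodule_map C R M M (Idt C (bm_ob M))"
  using bimodule_simps[of R M] by (auto simp: is_bimodule_map_def tens_simps)

text \<open>The map \<open>f \<otimes> g\<close> descends to the quotients: \<open>f\<close> commutes with the right actions and \<open>g\<close> with the left
actions, so it carries the parallel pair defining \<open>M \<otimes>\<^sub>R N\<close> to the one defining \<open>M' \<otimes>\<^sub>R N'\<close>.\<close>

lemma tensor_over_map_simps:
  assumes R: "is_monoid C R" and M: "is_bimodule C R M" and N: "is_bimodule C R N"
    and M': "is_bimodule C R M'" and N': "is_bimodule C R N'"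
    and f: "is_bimodule_map C R M M' f" and g: "is_bimodule_map C R N N' g"
  shows "tensor_over_map C R M N M' N' f g \<in>
      hom C (tensor_over_ob C R M N) (tensor_over_ob C R M' N')"
    "tensor_over_map C R M N M' N' f g \<cdot> tensor_over_proj C R M N =
      tensor_over_proj C R M' N' \<cdot> (f \<otimes> g)"
proof -
  have r: "mon_ob R \<in> Ob C" using R unfolding is_monoid_def Let_def by blast
  have f': "f \<in> Ar C" "Dom C f = bm_ob M" "Cod C f = bm_ob M'"
      "f \<cdot> bm_ract M = bm_ract M' \<cdot> (f \<otimes> Idt C (mon_ob R))"
    and g': "g \<in> Ar C" "Dom C g = bm_ob N" "Cod C g = bm_ob N'"
      "g \<cdot> bm_lact N = bm_lact N' \<cdot> (Idt C (mon_ob R) \<otimes> g)"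
    using f g by (auto simp: is_bimodule_map_def in_hom_iff)
  let ?p = "tensor_over_proj C R M' N'"
  note p = tensor_over_proj_simps[OF R M' N']
  note S = arr_simps Tens_ob_closed Tens_simps interchange interchange_Cmp Assoc_simps r f' g'
    bimodule_simps[OF M] bimodule_simps[OF N] bimodule_simps[OF M'] bimodule_simps[OF N']
    p(1)[unfolded in_hom_iff]
  have "(?p \<cdot> (f \<otimes> g)) \<cdot> (bm_ract M \<otimes> Idt C (bm_ob N)) =
      (?p \<cdot> (bm_ract M' \<otimes> Idt C (bm_ob N'))) \<cdot> ((f \<otimes> Idt C (mon_ob R)) \<otimes> g)"
    by (simp add: S)
  also have "\<dots> = ?p \<cdot> (Idt C (bm_ob M') \<otimes> bm_lact N') \<cdot>
      Assoc C (bm_ob M') (mon_ob R) (bm_ob N') \<cdot> ((f \<otimes> Idt C (mon_ob R)) \<otimes> g)"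
    unfolding p(2) by (simp add: S)
  also have "Assoc C (bm_ob M') (mon_ob R) (bm_ob N') \<cdot> ((f \<otimes> Idt C (mon_ob R)) \<otimes> g) =
      (f \<otimes> (Idt C (mon_ob R) \<otimes> g)) \<cdot> Assoc C (bm_ob M) (mon_ob R) (bm_ob N)"
    by (rule Assoc_natural) (simp_all add: S)
  also have "?p \<cdot> (Idt C (bm_ob M') \<otimes> bm_lact N') \<cdot> (f \<otimes> (Idt C (mon_ob R) \<otimes> g)) \<cdot>
        Assoc C (bm_ob M) (mon_ob R) (bm_ob N) =
      (?p \<cdot> (f \<otimes> g)) \<cdot> (Idt C (bm_ob M) \<otimes> bm_lact N) \<cdot> Assoc C (bm_ob M) (mon_ob R) (bm_ob N)"
    by (simp add: S)
  finally have "\<exists>!h. h \<in> hom C (tensor_over_ob C R M N) (tensor_over_ob C R M' N') \<and>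
      h \<cdot> tensor_over_proj C R M N = ?p \<cdot> (f \<otimes> g)"
    by (intro tensor_over_induced[OF R M N]) (simp_all add: S)
  from theI'[OF this] show "tensor_over_map C R M N M' N' f g \<in>
      hom C (tensor_over_ob C R M N) (tensor_over_ob C R M' N')"
    "tensor_over_map C R M N M' N' f g \<cdot> tensor_over_proj C R M N =
      tensor_over_proj C R M' N' \<cdot> (f \<otimes> g)"
    by (simp_all add: tensor_over_map_def)
qed

lemma tensor_over_proj_epic:
  assumes R: "is_monoid C R" and M: "is_bimodule C R M" and N: "is_bimodule C R N"
    and u: "u \<in> hom C (tensor_over_ob C R M N) X" and v: "v \<in> hom C (tensor_over_ob C R M N) X"
    and eq: "u \<cdot> tensor_over_proj C R M N = v \<cdot> tensor_over_proj C R M N"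
  shows "u = v"
proof -
  have r: "mon_ob R \<in> Ob C" using R unfolding is_monoid_def Let_def by blast
  let ?p = "tensor_over_proj C R M N"
  note p = tensor_over_proj_simps[OF R M N]
  note S = arr_simps Tens_ob_closed Tens_simps Assoc_simps r
    bimodule_simps[OF M] bimodule_simps[OF N] p(1)[unfolded in_hom_iff] u[unfolded in_hom_iff]
  have "\<exists>!h. h \<in> hom C (tensor_over_ob C R M N) X \<and> h \<cdot> ?p = u \<cdot> ?p"
    by (rule tensor_over_induced[OF R M N]) (simp_all add: S p(2))
  then show ?thesis using u v eq by metis
qed

text \<open>Precomposing the two maps on \<open>I \<otimes>\<^sub>R I\<close> with the quotient map from \<open>I \<otimes> I\<close> loses nothing and
evaluates them: the condition is the one for gluing the actions of \<open>R\<close> on \<open>I\<close> along \<open>I \<otimes> I\<close>.\<close>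

lemma tensor_condition_iff:
  assumes R: "is_monoid C R" and I: "is_bimodule C R I"
    and j: "is_bimodule_map C R I (regular_bimodule R) j"
  shows "lact_iso C R I \<cdot> tensor_over_map C R I I (regular_bimodule R) I j (Idt C (bm_ob I)) =
      ract_iso C R I \<cdot> tensor_over_map C R I I I (regular_bimodule R) (Idt C (bm_ob I)) j \<longleftrightarrow>
    bm_lact I \<cdot> (j \<otimes> Idt C (bm_ob I)) = bm_ract I \<cdot> (Idt C (bm_ob I) \<otimes> j)"
proof -
  have r: "mon_ob R \<in> Ob C" using R unfolding is_monoid_def Let_def by blast
  note reg = regular_is_bimodule[OF R]
  note idI = Idt_bimodule_map[OF I r]
  let ?p = "tensor_over_proj C R I I"
  let ?u = "tensor_over_map C R I I (regular_bimodule R) I j (Idt C (bm_ob I))"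
  let ?v = "tensor_over_map C R I I I (regular_bimodule R) (Idt C (bm_ob I)) j"
  note u = tensor_over_map_simps[OF R I I reg I j idI]
  note v = tensor_over_map_simps[OF R I I I reg idI j]
  note p = tensor_over_proj_simps(1)[OF R I I]
  have j': "j \<in> hom C (bm_ob I) (mon_ob R)"
    using j by (auto simp: is_bimodule_map_def regular_bimodule_def)
  have regob: "bm_ob (regular_bimodule R) = mon_ob R" by (simp add: regular_bimodule_def)
  have idh: "Idt C (bm_ob I) \<in> hom C (bm_ob I) (bm_ob I)"
    by (rule Idt_hom) (rule bimodule_simps(1)[OF I])
  have "(lact_iso C R I \<cdot> ?u) \<cdot> ?p = lact_iso C R I \<cdot> ?u \<cdot> ?p"
    by (rule Cmp_assoc[OF p u(1) lact_iso_simps(1)[OF R I]])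
  also have "\<dots> = (lact_iso C R I \<cdot> tensor_over_proj C R (regular_bimodule R) I) \<cdot>
      (j \<otimes> Idt C (bm_ob I))"
    unfolding u(2)
    by (rule Cmp_assoc[OF Tens_hom[OF j' idh] tensor_over_proj_simps(1)[OF R reg I, unfolded regob]
        lact_iso_simps(1)[OF R I], symmetric])
  finally have up: "(lact_iso C R I \<cdot> ?u) \<cdot> ?p = bm_lact I \<cdot> (j \<otimes> Idt C (bm_ob I))"
    by (simp add: lact_iso_simps(2)[OF R I])
  have "(ract_iso C R I \<cdot> ?v) \<cdot> ?p = ract_iso C R I \<cdot> ?v \<cdot> ?p"
    by (rule Cmp_assoc[OF p v(1) ract_iso_simps(1)[OF R I]])
  also have "\<dots> = (ract_iso C R I \<cdot> tensor_over_proj C R I (regular_bimodule R)) \<cdot>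
      (Idt C (bm_ob I) \<otimes> j)"
    unfolding v(2)
    by (rule Cmp_assoc[OF Tens_hom[OF idh j'] tensor_over_proj_simps(1)[OF R I reg, unfolded regob]
        ract_iso_simps(1)[OF R I], symmetric])
  finally have vp: "(ract_iso C R I \<cdot> ?v) \<cdot> ?p = bm_ract I \<cdot> (Idt C (bm_ob I) \<otimes> j)"
    by (simp add: ract_iso_simps(2)[OF R I])
  have "lact_iso C R I \<cdot> ?u = ract_iso C R I \<cdot> ?v \<longleftrightarrow>
      (lact_iso C R I \<cdot> ?u) \<cdot> ?p = (ract_iso C R I \<cdot> ?v) \<cdot> ?p"
    using tensor_over_proj_epic[OF R I I Cmp_hom[OF u(1) lact_iso_simps(1)[OF R I]]
      Cmp_hom[OF v(1) ract_iso_simps(1)[OF R I]]] by auto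
  then show ?thesis unfolding up vp .
qed

section \<open>The correspondence\<close>

text \<open>If the right action on \<open>I \<otimes> R\<close> and the left action on \<open>R \<otimes> I\<close> agree on \<open>I \<otimes> I\<close>, their
copairing is the upper component of the multiplication.\<close>

definition smith_ideal_of :: "('o, 'm) mon \<times> ('o, 'm) bimod \<times> 'm \<Rightarrow> ('m, 'm square) mon" where
  "smith_ideal_of = (\<lambda>(R, I, j).
    \<lparr>mon_ob = j,
     mon_mult = Square (pp_ob C j j) j (copair C (pp_cocone C j j) (bm_ract I) (bm_lact I)) (mon_mult R),
     mon_unit = Square (pp_unit C) j (from_initial C (bm_ob I)) (mon_unit R)\<rparr>)"

text \<open>The gluing condition is inherited from the pushout square. A Smith ideal is recovered from its
data because maps out of a pushout and out of the initial object are unique.\<close>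

lemma smith_data_of_smith_ideal:
  assumes A: "is_smith_ideal C A" and D: "smith_data C A = (R, I, j)"
  shows "is_monoid C R" "is_bimodule C R I" "is_bimodule_map C R I (regular_bimodule R) j"
    "bm_lact I \<cdot> (j \<otimes> Idt C (bm_ob I)) = bm_ract I \<cdot> (Idt C (bm_ob I) \<otimes> j)"
    "smith_ideal_of (R, I, j) = A"
proof -
  define t m z e where "t = sq_top (mon_mult A)" and "m = sq_bot (mon_mult A)"
    and "z = sq_top (mon_unit A)" and "e = sq_bot (mon_unit A)"
  have R: "R = \<lparr>mon_ob = Cod C j, mon_mult = m, mon_unit = e\<rparr>"
    and I: "I = \<lparr>bm_ob = Dom C j, bm_lact = t \<cdot> pp_in2 C j j, bm_ract = t \<cdot> pp_in1 C j j\<rparr>"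
    and jA: "j = mon_ob A"
    using D by (auto simp: smith_data_def Let_def t_def m_def e_def)
  have "mon_mult A \<in> hom (Arr_pp C) (pp_ob C j j) j" "mon_unit A \<in> hom (Arr_pp C) (pp_unit C) j"
    using A by (auto simp: is_smith_ideal_def is_monoid_def Let_def jA Arr_pp_def)
  then have j: "j \<in> Ar C" and t: "t \<in> hom C (Dom C (pp_ob C j j)) (Dom C j)"
    and m: "m \<in> hom C (Cod C (pp_ob C j j)) (Cod C j)"
    and z: "z \<in> hom C (initial C) (Dom C j)" and e: "e \<in> hom C (Unt C) (Cod C j)"
    and mult: "mon_mult A = Square (pp_ob C j j) j t m"
    and unit: "mon_unit A = Square (pp_unit C) j z e"
    by (auto simp: Arr_pp_hom_iff t_def m_def z_def e_def pp_unit_simps square.expand)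
  have m: "m \<in> hom C (Cod C j \<otimes>\<^sub>o Cod C j) (Cod C j)"
    using m j by (simp add: pp_simps)
  have A_eq: "A = \<lparr>mon_ob = j, mon_mult = Square (pp_ob C j j) j t m,
      mon_unit = Square (pp_unit C) j z e\<rparr>"
    by (cases A) (use jA mult unit in simp)
  show "is_monoid C R" "is_bimodule C R I" "is_bimodule_map C R I (regular_bimodule R) j"
    using is_smith_ideal_iff[OF j t m z e] A unfolding A_eq R I by auto
  have square: "(t \<cdot> pp_in1 C j j) \<cdot> (Idt C (Dom C j) \<otimes> j) =
      (t \<cdot> pp_in2 C j j) \<cdot> (j \<otimes> Idt C (Dom C j))"
    using pp_square[OF j j] j t by (simp add: tens_simps pp_simps)
  then show "bm_lact I \<cdot> (j \<otimes> Idt C (bm_ob I)) = bm_ract I \<cdot> (Idt C (bm_ob I) \<otimes> j)"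
    by (simp add: I)
  have "copair C (pp_cocone C j j) (t \<cdot> pp_in1 C j j) (t \<cdot> pp_in2 C j j) = t"
    by (rule pp_jointly_epic[OF j j])
      (use pp_copair[OF j j _ _ _ _ _ square] j t in \<open>simp_all add: arr_simps pp_simps\<close>)
  moreover have "from_initial C (Dom C j) = z"
    by (rule is_initial_unique[OF initial_is_initial from_initial_hom z]) (use j in \<open>simp add: arr_simps\<close>)
  ultimately show "smith_ideal_of (R, I, j) = A"
    by (simp add: smith_ideal_of_def A_eq R I)
qed

lemma smith_ideal_of_smith_data:
  assumes R: "is_monoid C R" and I: "is_bimodule C R I"
    and map: "is_bimodule_map C R I (regular_bimodule R) j"
    and eq: "bm_lact I \<cdot> (j \<otimes> Idt C (bm_ob I)) = bm_ract I \<cdot> (Idt C (bm_ob I) \<otimes> j)"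
  shows "is_smith_ideal C (smith_ideal_of (R, I, j))"
    "smith_data C (smith_ideal_of (R, I, j)) = (R, I, j)"
proof -
  have j: "j \<in> Ar C" "Dom C j = bm_ob I" "Cod C j = mon_ob R"
    using map by (auto simp: is_bimodule_map_def regular_bimodule_def in_hom_iff)
  define t where "t = copair C (pp_cocone C j j) (bm_ract I) (bm_lact I)"
  have t: "t \<in> Ar C" "Dom C t = Dom C (pp_ob C j j)" "Cod C t = bm_ob I"
    "t \<cdot> pp_in1 C j j = bm_ract I" "t \<cdot> pp_in2 C j j = bm_lact I"
    using pp_copair[OF j(1) j(1), of "bm_ract I" "bm_lact I"] bimodule_simps[OF I] j eq
    by (simp_all add: t_def pp_simps)
  have I_eq: "\<lparr>bm_ob = Dom C j, bm_lact = t \<cdot> pp_in2 C j j, bm_ract = t \<cdot> pp_in1 C j j\<rparr> = I"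
    by (simp add: t j)
  have R_eq: "\<lparr>mon_ob = Cod C j, mon_mult = mon_mult R, mon_unit = mon_unit R\<rparr> = R"
    by (simp add: j)
  show "smith_data C (smith_ideal_of (R, I, j)) = (R, I, j)"
    using I_eq R_eq by (simp add: smith_data_def smith_ideal_of_def flip: t_def)
  have "is_smith_ideal C \<lparr>mon_ob = j, mon_mult = Square (pp_ob C j j) j t (mon_mult R),
      mon_unit = Square (pp_unit C) j (from_initial C (bm_ob I)) (mon_unit R)\<rparr>"
  proof (subst is_smith_ideal_iff, unfold I_eq R_eq)
    show "mon_mult R \<in> hom C (Cod C j \<otimes>\<^sub>o Cod C j) (Cod C j)" "mon_unit R \<in> hom C (Unt C) (Cod C j)"
      using R j by (auto simp: is_monoid_def Let_def)
    show "from_initial C (bm_ob I) \<in> hom C (initial C) (Dom C j)"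
      using from_initial_hom[OF bimodule_simps(1)[OF I]] j by simp
  qed (use R I map j t in \<open>simp_all add: in_hom_iff\<close>)
  then show "is_smith_ideal C (smith_ideal_of (R, I, j))"
    by (simp add: smith_ideal_of_def flip: t_def)
qed

end

theorem proposition1p7:
  fixes C :: "('o, 'm, 'x) symmoncat_scheme"
  assumes "infinite (UNIV :: 'u set)"
    and "closed_symmetric_monoidal_category C"
    and "bicomplete TYPE('u) C"
  shows "bij_betw (smith_data C)
    {A. is_smith_ideal C A}
    {(R, I, j). is_monoid C R \<and> is_bimodule C R I \<and>
      is_bimodule_map C R I (regular_bimodule R) j \<and>
      lact_iso C R I \<cdot>\<^bsub>C\<^esub> tensor_over_map C R I I (regular_bimodule R) I j (Idt C (bm_ob I)) =
      ract_iso C R I \<cdot>\<^bsub>C\<^esub> tensor_over_map C R I I I (regular_bimodule R) (Idt C (bm_ob I)) j}"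
proof -
  interpret closed_symmetric_monoidal_category C by fact
  interpret finitely_cocomplete_closed_category C
    using has_initial has_pushouts has_coequalizers assms(1,3) by unfold_locales blast+
  let ?S = "{A. is_smith_ideal C A}"
  let ?T = "{(R, I, j). is_monoid C R \<and> is_bimodule C R I \<and>
      is_bimodule_map C R I (regular_bimodule R) j \<and>
      lact_iso C R I \<cdot>\<^bsub>C\<^esub> tensor_over_map C R I I (regular_bimodule R) I j (Idt C (bm_ob I)) =
      ract_iso C R I \<cdot>\<^bsub>C\<^esub> tensor_over_map C R I I I (regular_bimodule R) (Idt C (bm_ob I)) j}"
  have data: "smith_ideal_of (smith_data C A) = A \<and> smith_data C A \<in> ?T" if A: "A \<in> ?S" for A
  proof -
    obtain R I j where D: "smith_data C A = (R, I, j)" by (rule prod_cases3)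
    show ?thesis
      using A smith_data_of_smith_ideal[of A R I j] by (simp add: D tensor_condition_iff)
  qed
  have ideal: "smith_data C (smith_ideal_of D) = D \<and> smith_ideal_of D \<in> ?S" if "D \<in> ?T" for D
    using that by (auto simp: tensor_condition_iff smith_ideal_of_smith_data)
  show ?thesis
  proof (rule bij_betw_byWitness[where f' = smith_ideal_of])
    show "\<forall>A \<in> ?S. smith_ideal_of (smith_data C A) = A"
      by (rule ballI) (rule conjunct1[OF data])
    show "\<forall>D \<in> ?T. smith_data C (smith_ideal_of D) = D"
      by (rule ballI) (rule conjunct1[OF ideal])
    show "smith_data C ` ?S \<subseteq> ?T"
      by (rule image_subsetI) (rule conjunct2[OF data])
    show "smith_ideal_of ` ?T \<subseteq> ?S"
      by (rule image_subsetI) (rule conjunct2[OF ideal])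
  qed
qed

end
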